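(* For $N\ge 0$ let $b_N$ be the number of proper triangulations of a convex $(N+2)$-gon $P$ whose vertices have been colored cyclically with the three colors $1,2,3$ (with the last vertex colored $2$ instead if $N+2$ is congruent to $1$ modulo $3$). Then, for all $n\in\mathbb{N}$, $$ b_{3n}=\frac{1}{3n+1}\binom{4n}{n},\qquad b_{3n+1}=\frac{2}{3n+2}\binom{4n+1}{n},\qquad b_{3n+2}=\frac{3}{3n+3}\binom{4n+2}{n}. $$
   Context: $\mathbb{N}$ denotes the nonnegative integers. $P$ is a convex polygon drawn with a horizontal edge at the top. The vertices are colored counterclockwise with the sequence $1,2,3,1,2,3,\ldots$, starting at the left endpoint of the top edge; the last vertex is the right endpoint of the top edge, and if $N+2\equiv 1 \pmod 3$ this last vertex is recolored $2$. A triangulation of $P$ is a set of chords between vertices of $P$, no two crossing in the interior of $P$, such that all bounded regions are triangles with vertices among those of $P$. It is proper if every triangle contains all three colors among its vertices. By convention, a polygon with $2$ vertices is a single edge and has exactly one proper triangulation, so $b_0=1$. *)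

theory Defs
  imports "HOL-Analysis.Analysis"
begin

text \<open>
  The plane is \<^typ>\<open>complex\<close>. A polygon with \<open>n\<close> vertices is given by its list of vertices
  \<open>p 0, \<dots>, p (n - 1)\<close>; values of \<open>p\<close> beyond that are irrelevant.
\<close>

definition ccw :: "complex \<Rightarrow> complex \<Rightarrow> complex \<Rightarrow> bool" where
  "ccw a b c \<longleftrightarrow> 0 < Im (cnj (b - a) * (c - a))"

text \<open>
  Strictly convex position, vertices listed counterclockwise, the top edge being the horizontal
  edge from \<open>p 0\<close> (left) to \<open>p (n - 1)\<close> (right). By \<^const>\<open>ccw\<close>, all other vertices
  lie below that edge. Injectivity only matters for \<open>n = 2\<close>, where the polygon is a single edge.
\<close>

definition convex_polygon :: "nat \<Rightarrow> (nat \<Rightarrow> complex) \<Rightarrow> bool" where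
  "convex_polygon n p \<longleftrightarrow> 2 \<le> n \<and> inj_on p {..<n} \<and>
     (\<forall>i j k. i < j \<and> j < k \<and> k < n \<longrightarrow> ccw (p i) (p j) (p k)) \<and>
     Im (p 0) = Im (p (n - 1)) \<and> Re (p 0) < Re (p (n - 1))"

definition polygon :: "nat \<Rightarrow> (nat \<Rightarrow> complex) \<Rightarrow> complex set" where
  "polygon n p = convex hull (p ` {..<n})"

text \<open>
  A chord joins two non-adjacent vertices; it is encoded by its endpoints \<open>(i, j)\<close> with
  \<open>i < j\<close>. The sides of the polygon are not chords, since they are always part of the drawing.
\<close>

definition chords :: "nat \<Rightarrow> (nat \<times> nat) set" where
  "chords n = {(i, j). i + 1 < j \<and> j < n \<and> \<not> (i = 0 \<and> j = n - 1)}"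

definition chord_segment :: "(nat \<Rightarrow> complex) \<Rightarrow> nat \<times> nat \<Rightarrow> complex set" where
  "chord_segment p c = closed_segment (p (fst c)) (p (snd c))"

definition bounded_regions :: "nat \<Rightarrow> (nat \<Rightarrow> complex) \<Rightarrow> (nat \<times> nat) set \<Rightarrow> complex set set" where
  "bounded_regions n p T =
     {R \<in> components (- (frontier (polygon n p) \<union> (\<Union>c\<in>T. chord_segment p c))). bounded R}"

definition open_triangle :: "(nat \<Rightarrow> complex) \<Rightarrow> nat \<Rightarrow> nat \<Rightarrow> nat \<Rightarrow> complex set" where
  "open_triangle p i j k = interior (convex hull {p i, p j, p k})"

definition triangulation :: "nat \<Rightarrow> (nat \<Rightarrow> complex) \<Rightarrow> (nat \<times> nat) set \<Rightarrow> bool" where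
  "triangulation n p T \<longleftrightarrow> T \<subseteq> chords n \<and>
     (\<forall>c\<in>T. \<forall>d\<in>T. c \<noteq> d \<longrightarrow>
        chord_segment p c \<inter> chord_segment p d \<inter> interior (polygon n p) = {}) \<and>
     (\<forall>R\<in>bounded_regions n p T. \<exists>i j k. i < j \<and> j < k \<and> k < n \<and> R = open_triangle p i j k)"

text \<open>
  Vertices are numbered from \<open>0\<close>, so the colors are \<open>1, 2, 3, 1, 2, 3, \<dots>\<close>, except that
  the last vertex gets color \<open>2\<close> if the number of vertices is \<open>1\<close> modulo \<open>3\<close>.
\<close>

definition vertex_color :: "nat \<Rightarrow> nat \<Rightarrow> nat" where
  "vertex_color n i = (if n mod 3 = 1 \<and> i = n - 1 then 2 else i mod 3 + 1)"

definition proper_triangulation :: "nat \<Rightarrow> (nat \<Rightarrow> complex) \<Rightarrow> (nat \<times> nat) set \<Rightarrow> bool" where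
  "proper_triangulation n p T \<longleftrightarrow> triangulation n p T \<and>
     (\<forall>i j k. i < j \<and> j < k \<and> k < n \<and> open_triangle p i j k \<in> bounded_regions n p T \<longrightarrow>
        vertex_color n ` {i, j, k} = {1, 2, 3})"

text \<open>
  The number \<open>b\<^sub>N\<close> for a given polygon with \<open>N + 2\<close> vertices. For \<open>N = 0\<close> the drawing is a
  single segment, there are no chords and no bounded regions, and the empty set is the only proper
  triangulation.
\<close>

definition num_proper :: "nat \<Rightarrow> (nat \<Rightarrow> complex) \<Rightarrow> nat" where
  "num_proper N p = card {T. proper_triangulation (N + 2) p T}"

text \<open>Convex polygons exist for every number of vertices: take points on a parabola.\<close>

lemma convex_polygon_exists:
  assumes "2 \<le> n"
  shows "\<exists>p. convex_polygon n p"
proof -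
  define x where "x i = real i - real (n - 1) / 2" for i
  define p where "p i = Complex (x i) ((x i)\<^sup>2)" for i
  have "ccw (p i) (p j) (p k)" if "i < j" "j < k" for i j k
  proof -
    have "x i < x j" "x j < x k" using that by (auto simp: x_def)
    moreover have "Im (cnj (p j - p i) * (p k - p i)) = (x j - x i) * (x k - x i) * (x k - x j)"
      by (simp add: p_def algebra_simps power2_eq_square)
    ultimately show ?thesis by (simp add: ccw_def)
  qed
  moreover have "inj_on p {..<n}"
    by (auto simp: inj_on_def p_def x_def)
  moreover have "Im (p 0) = Im (p (n - 1))" "Re (p 0) < Re (p (n - 1))"
    using assms by (auto simp: p_def x_def power2_eq_square field_simps)
  ultimately have "convex_polygon n p"
    using assms by (auto simp: convex_polygon_def)
  then show ?thesis by blast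
qed

end

theory Submission imports Defs begin

text \<open>
  A triangulation of a polygon with at least three vertices has a unique triangle on its top edge,
  and cutting along the other two sides of that triangle leaves two smaller triangulated polygons.
  This decomposition turns the count into a recursion over the position of the apex. Two things
  have to be supplied: the geometric proof of the decomposition, and the solution of the recursion.

  \<^emph>\<open>Geometry.\<close> The bounded regions of the drawing are the connected components of the interior
  of the polygon minus the chords. The component near the midpoint of the base edge of a
  subpolygon with vertices \<open>a, \<dots>, b\<close> is by assumption an open triangle, and because its closure
  contains that midpoint, its vertices are \<open>a\<close>, \<open>k\<close>, \<open>b\<close> for some \<open>k\<close> in between. No chord
  can run past \<open>k\<close>, since it would cut through this triangle; and the two new sides of the triangle
  must be chords or sides of the polygon, since a region cannot end where nothing is drawn. Hence the
  chords split (lemma \<open>proper_dissection_split\<close>), and conversely two dissected subpolygons can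
  be glued along a triangle (lemma \<open>proper_dissection_glue\<close>). Both rest on \<open>hull_cut\<close>: a line
  through two vertices splits the polygon into the hulls of the vertices on either side. It
  follows inductively that chords whose regions are all triangles never cross
  (lemma \<open>proper_dissection_noncrossing\<close>).

  \<^emph>\<open>Counting.\<close> Let \<open>U\<close> be the power series with \<open>U = 1 + x U\<^sup>4\<close>. With the cyclic coloring, the
  coloring of the top triangle fixes the apex modulo 3. Subpolygons whose ends have
  distance \<open>3m + 1\<close> or \<open>3m + 2\<close> then have generating functions \<open>A\<close> and \<open>B\<close> with
  \<open>A = 1 + x B\<^sup>2\<close> and \<open>B = A\<^sup>2\<close>, so \<open>A = U\<close> and \<open>B = U\<^sup>2\<close>. If the last vertex is recolored, the
  distances \<open>3m + 3\<close> and \<open>3m + 1\<close> give \<open>C\<close> and \<open>D\<close> with \<open>C = B D\<close> and \<open>D = 1 + x A C\<close>, so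
  \<open>D = U\<close> and \<open>C = U\<^sup>3\<close>. Therefore the three numbers are the coefficients of
  \<open>U\<close>, \<open>U\<^sup>2\<close> and \<open>U\<^sup>3\<close>, which are Fuss--Catalan numbers.
\<close>

section \<open>Fuss--Catalan numbers\<close>

text \<open>
  The coefficient of \<open>x\<^sup>m\<close> in \<open>U\<^sup>r\<close>, where \<open>U = 1 + x
  U\<^sup>4\<close>; the last equation is \<open>U\<^sup>r\<^sup>+\<^sup>1 = U\<^sup>r + x
  U\<^sup>r\<^sup>+\<^sup>4\<close>. Taking all powers at once gives a recursion without products,
  from which both the convolution and the closed form follow by induction.
\<close>

fun fuss_catalan :: "nat \<Rightarrow> nat \<Rightarrow> nat" where
  "fuss_catalan 0 r = 1"
| "fuss_catalan (Suc m) 0 = 0"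
| "fuss_catalan (Suc m) (Suc r) = fuss_catalan (Suc m) r + fuss_catalan m (r + 4)"

text \<open>
  This is \<open>U\<^sup>r U\<^sup>s = U\<^sup>r\<^sup>+\<^sup>s\<close>.
\<close>

lemma fuss_catalan_convolution:
  "(\<Sum>i\<le>m. fuss_catalan i r * fuss_catalan (m - i) s) = fuss_catalan m (r + s)"
proof (induction m r rule: fuss_catalan.induct)
  case (1 r)
  show ?case by simp
next
  case (2 m)
  have "fuss_catalan (Suc i) 0 = 0" for i by simp
  then show ?case by (subst sum.atMost_Suc_shift) simp
next
  case (3 m r)
  have "(\<Sum>i\<le>Suc m. fuss_catalan i (Suc r) * fuss_catalan (Suc m - i) s)
      = fuss_catalan (Suc m) s + (\<Sum>i\<le>m. fuss_catalan (Suc i) r * fuss_catalan (m - i) s)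
        + (\<Sum>i\<le>m. fuss_catalan i (r + 4) * fuss_catalan (m - i) s)"
    by (subst sum.atMost_Suc_shift) (simp add: sum.distrib algebra_simps)
  also have "fuss_catalan (Suc m) s + (\<Sum>i\<le>m. fuss_catalan (Suc i) r * fuss_catalan (m - i) s)
      = (\<Sum>i\<le>Suc m. fuss_catalan i r * fuss_catalan (Suc m - i) s)"
    by (subst sum.atMost_Suc_shift) simp
  finally show ?case using 3 by (simp add: add_ac)
qed

text \<open>
  Both summands of the recursion have the same value \<open>N = 4m + r + 4\<close> as the upper
  index of their binomial coefficient, so the induction step only relates adjacent entries of one
  row of Pascal's triangle.
\<close>

lemma fuss_catalan_binomial:
  "(4 * m + r) * fuss_catalan m r = r * ((4 * m + r) choose m)"
proof (induction m r rule: fuss_catalan.induct)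
  case (3 m r)
  define N where "N = 4 * m + r + 4"
  define X where "X = real (N choose Suc m)"
  define Y where "Y = real (N choose m)"
  define x where "x = real (fuss_catalan (Suc m) r)"
  define y where "y = real (fuss_catalan m (r + 4))"
  have N: "4 * Suc m + r = N" "4 * m + (r + 4) = N" "4 * Suc m + Suc r = Suc N" by (simp_all add: N_def)
  have 1: "real N * x = real r * X"
    using arg_cong[OF 3(1), of real] unfolding N x_def X_def by simp
  have 2: "real N * y = (real r + 4) * Y"
    using arg_cong[OF 3(2), of real] unfolding N y_def Y_def by simp
  have "Suc m * (N choose Suc m) = (N - m) * (N choose m)"
    by (metis binomial_absorption binomial_absorb_comp mult.commute)
  then have "real (Suc m * (N choose Suc m)) = real ((N - m) * (N choose m))" by simp
  then have 3: "(real m + 1) * X = (real N - real m) * Y"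
    unfolding of_nat_mult X_def Y_def by (simp add: of_nat_diff N_def add.commute)
  have rN: "real N = 4 * real m + real r + 4" by (simp add: N_def)
  have "real N * ((real N + 1) * (x + y)) = (real N + 1) * (real N * x + real N * y)"
    by (simp add: algebra_simps)
  also have "\<dots> = (real N + 1) * (real r * X + (real r + 4) * Y)" unfolding 1 2 ..
  also have "\<dots> = real N * ((real r + 1) * (X + Y))
      + 4 * ((real N - real m) * Y - (real m + 1) * X)"
    unfolding rN by (simp add: algebra_simps)
  finally have "real N * ((real N + 1) * (x + y)) = real N * ((real r + 1) * (X + Y))"
    using 3 by simp
  then have "(real N + 1) * (x + y) = (real r + 1) * (X + Y)" using rN by simp
  then have "real (Suc N * (fuss_catalan (Suc m) r + fuss_catalan m (r + 4)))
      = real (Suc r * ((N choose m) + (N choose Suc m)))"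
    by (simp add: x_def y_def X_def Y_def algebra_simps)
  then have "Suc N * (fuss_catalan (Suc m) r + fuss_catalan m (r + 4))
      = Suc r * ((N choose m) + (N choose Suc m))" by (rule of_nat_eq_iff[THEN iffD1])
  then show ?case unfolding N by simp
qed auto

lemma fuss_catalan_closed_form:
  "(3 * m + Suc r) * fuss_catalan m (Suc r) = Suc r * ((4 * m + r) choose m)"
proof -
  define N where "N = 4 * m + r"
  define F where "F = fuss_catalan m (Suc r)"
  have 1: "(3 * m + Suc r) * (Suc N choose m) = Suc N * (N choose m)"
    using binomial_absorb_comp[of "Suc N" m] by (simp add: N_def)
  have 2: "Suc N * F = Suc r * (Suc N choose m)"
    using fuss_catalan_binomial[of m "Suc r"] by (simp add: N_def F_def)
  have "Suc N * ((3 * m + Suc r) * F) = (3 * m + Suc r) * (Suc N * F)"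
    by (rule mult.left_commute)
  also have "\<dots> = Suc r * ((3 * m + Suc r) * (Suc N choose m))"
    unfolding 2 by (rule mult.left_commute)
  also have "\<dots> = Suc N * (Suc r * (N choose m))"
    unfolding 1 by (rule mult.left_commute)
  finally show ?thesis unfolding N_def[symmetric] F_def[symmetric] by (metis mult_cancel1 nat.distinct(1))
qed

lemma rainbow_iff:
  "{x mod 3 + 1, y mod 3 + 1, z mod 3 + 1} = {1, 2, 3 :: nat} \<longleftrightarrow>
     x mod 3 \<noteq> y mod 3 \<and> y mod 3 \<noteq> z mod 3 \<and> x mod 3 \<noteq> z mod 3"
proof -
  have r: "w mod 3 = 0 \<or> w mod 3 = 1 \<or> w mod 3 = 2" for w :: nat by arith
  have "{X + 1, Y + 1, Z + 1} = {1, 2, 3 :: nat} \<longleftrightarrow> X \<noteq> Y \<and> Y \<noteq> Z \<and> X \<noteq> Z"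
    if "X = 0 \<or> X = 1 \<or> X = 2" "Y = 0 \<or> Y = 1 \<or> Y = 2" "Z = 0 \<or> Z = 1 \<or> Z = 2" for X Y Z :: nat
    using that by (elim disjE; simp add: set_eq_subset)
  from this[OF r r r] show ?thesis .
qed

text \<open>
  If \<open>z\<close> differs from \<open>a\<close> modulo 3, the third residue class is determined
  by both; \<open>d\<close> and \<open>3 - d\<close> are the two nonzero differences.
\<close>

lemma third_residue_iff:
  fixes a d k z :: nat
  assumes d: "0 < d" "d < 3" and z: "z mod 3 = (a + (3 - d)) mod 3"
  shows "a mod 3 \<noteq> k mod 3 \<and> k mod 3 \<noteq> z mod 3 \<and> a mod 3 \<noteq> z mod 3 \<longleftrightarrow> k mod 3 = (a + d) mod 3"
proof -
  have r: "w mod 3 = 0 \<or> w mod 3 = 1 \<or> w mod 3 = 2" for w :: nat by arith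
  have "A \<noteq> K \<and> K \<noteq> (A + (3 - d)) mod 3 \<and> A \<noteq> (A + (3 - d)) mod 3 \<longleftrightarrow> K = (A + d) mod 3"
    if "A = 0 \<or> A = 1 \<or> A = 2" "K = 0 \<or> K = 1 \<or> K = 2" for A K :: nat
  proof -
    have "d = 1 \<or> d = 2" using d by auto
    then show ?thesis using that by (elim disjE; simp)
  qed
  from this[OF r r, of a k] show ?thesis unfolding z by (simp only: mod_add_left_eq)
qed

lemma residue_class_between:
  fixes a b d M :: nat
  assumes d: "0 < d" "d < 3" and M: "\<And>i. a + 3 * i + d < b \<longleftrightarrow> i < M"
  shows "{k. a < k \<and> k < b \<and> k mod 3 = (a + d) mod 3} = (\<lambda>i. a + 3 * i + d) ` {..<M}"
proof (intro set_eqI iffI)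
  fix k assume "k \<in> {k. a < k \<and> k < b \<and> k mod 3 = (a + d) mod 3}"
  then have k: "a < k" "k < b" "k mod 3 = (a + d) mod 3" by auto
  have "d = 1 \<or> d = 2" using d by auto
  then have "k \<ge> a + d"
    using k by (elim disjE; presburger)
  moreover have "3 dvd k - (a + d)" using k(3) calculation mod_eq_dvd_iff_nat by blast
  then obtain i where "k - (a + d) = 3 * i" by (auto simp: dvd_def)
  ultimately have "k = a + 3 * i + d" by simp
  then show "k \<in> (\<lambda>i. a + 3 * i + d) ` {..<M}" using k M by auto
next
  fix k assume "k \<in> (\<lambda>i. a + 3 * i + d) ` {..<M}"
  then obtain i where i: "k = a + 3 * i + d" "i < M" by auto
  moreover have "(a + 3 * i + d) mod 3 = (a + d) mod 3" by presburger
  ultimately show "k \<in> {k. a < k \<and> k < b \<and> k mod 3 = (a + d) mod 3}"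
    using M[of i] d by simp
qed

section \<open>Components and convex hulls\<close>

lemma components_Un_disjoint_open:
  assumes "open A" "open B" "A \<inter> B = {}"
  shows "components (A \<union> B) = components A \<union> components B"
proof -
  have cc: "connected_component_set (A \<union> B) x = connected_component_set A x"
    if "open A" "open B" "A \<inter> B = {}" "x \<in> A" for A B :: "'a set" and x
  proof (rule antisym)
    let ?C = "connected_component_set (A \<union> B) x"
    have x: "x \<in> ?C" using that(4) by (simp add: connected_component_refl_eq)
    have "?C \<subseteq> A \<union> B" by (rule connected_component_subset)
    then have "B \<inter> ?C = {} \<or> A \<inter> ?C = {}"
      using connectedD[OF connected_connected_component, of A B "A \<union> B" x] that by blast
    then have "?C \<subseteq> A"
      using x that(4) connected_component_subset[of "A \<union> B" x] by blast
    then show "?C \<subseteq> connected_component_set A x"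
      by (meson x connected_component_maximal connected_connected_component)
  next
    show "connected_component_set A x \<subseteq> connected_component_set (A \<union> B) x"
      by (rule connected_component_mono) blast
  qed
  have "connected_component_set (A \<union> B) x = connected_component_set A x" if "x \<in> A" for x
    using cc[of A B x] that assms by blast
  moreover have "connected_component_set (A \<union> B) x = connected_component_set B x" if "x \<in> B" for x
    using cc[of B A x] that assms by (simp add: Un_commute Int_commute)
  ultimately show ?thesis by (simp add: components_def image_Un)
qed

text \<open>
  A point of the hull in the halfspace lies on a segment from the hull of \<open>S1\<close> to the
  hull of \<open>S2\<close>; that segment crosses the hyperplane at a point which again belongs to
  the hull of \<open>S1\<close>, and so does everything before the crossing.
\<close>

lemma convex_hull_Int_halfspace:
  fixes S1 S2 :: "'a::euclidean_space set"
  assumes S1: "\<And>x. x \<in> S1 \<Longrightarrow> w \<bullet> x \<le> b" and S2: "\<And>x. x \<in> S2 \<Longrightarrow> b \<le> w \<bullet> x"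
    and line: "convex hull (S1 \<union> S2) \<inter> {x. w \<bullet> x = b} \<subseteq> convex hull S1"
  shows "convex hull (S1 \<union> S2) \<inter> {x. w \<bullet> x \<le> b} = convex hull S1"
proof
  have "convex hull S1 \<subseteq> {x. w \<bullet> x \<le> b}"
    by (rule hull_minimal) (auto simp: S1 convex_halfspace_le)
  then show "convex hull S1 \<subseteq> convex hull (S1 \<union> S2) \<inter> {x. w \<bullet> x \<le> b}"
    by (simp add: hull_mono)
  show "convex hull (S1 \<union> S2) \<inter> {x. w \<bullet> x \<le> b} \<subseteq> convex hull S1"
  proof
    fix z assume z: "z \<in> convex hull (S1 \<union> S2) \<inter> {x. w \<bullet> x \<le> b}"
    have ge: "convex hull S2 \<subseteq> {x. b \<le> w \<bullet> x}"
      by (rule hull_minimal) (auto simp: S2 convex_halfspace_ge)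
    show "z \<in> convex hull S1"
    proof (cases "S1 = {} \<or> S2 = {}")
      case True
      then show ?thesis
      proof
        assume "S1 = {}"
        then have "z \<in> convex hull S2" using z by simp
        then have "w \<bullet> z = b" using z ge by force
        then show ?thesis using z line by blast
      qed (use z in simp)
    next
      case False
      then obtain x1 x2 where x: "x1 \<in> convex hull S1" "x2 \<in> convex hull S2" "between (x1, x2) z"
      proof -
        have "z \<in> convex hull (convex hull S1 \<union> convex hull S2)"
          using z hull_mono[of "S1 \<union> S2" "convex hull S1 \<union> convex hull S2" convex]
            hull_subset[of S1 convex] hull_subset[of S2 convex] by blast
        then obtain u v s t where *: "z = u *\<^sub>R s + v *\<^sub>R t" "u \<ge> 0" "v \<ge> 0" "u + v = 1"
            "s \<in> convex hull S1" "t \<in> convex hull S2"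
          using False by (auto simp: convex_hull_union_two)
        then have "z = (1 - v) *\<^sub>R s + v *\<^sub>R t" "v \<le> 1" by (auto simp: eq_diff_eq[symmetric])
        then have "z \<in> closed_segment s t"
          using *(3) unfolding in_segment by blast
        then show ?thesis using that * by (auto simp: between_mem_segment)
      qed
      \<comment> \<open>The crossing point is sought beyond \<open>z\<close>, so that \<open>z\<close> lies between \<open>x1\<close> and \<open>y\<close>.\<close>
      have "connected (closed_segment z x2)" "z \<in> closed_segment z x2" "x2 \<in> closed_segment z x2"
        by auto
      then obtain y where y: "y \<in> closed_segment z x2" "w \<bullet> y = b"
        using connected_ivt_hyperplane[of "closed_segment z x2" z x2 w b] z x(2) ge by auto
      have zin: "z \<in> convex hull (S1 \<union> S2)" using z by simp
      have x2in: "x2 \<in> convex hull (S1 \<union> S2)"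
        using x(2) hull_mono[of S2 "S1 \<union> S2" convex] by blast
      have "y \<in> convex hull (S1 \<union> S2)"
        using closed_segment_subset[OF zin x2in] y(1) by auto
      then have y1: "y \<in> convex hull S1" using line y(2) by blast
      have "between (x2, x1) z" using x(3) by (simp add: between_commute)
      moreover have "between (z, x2) y" using y(1) by (simp add: between_mem_segment)
      ultimately have "between (x1, y) z"
        using between_trans_2[of x2 x1 z y] by simp
      then show ?thesis
        using closed_segment_subset[OF x(1) y1] by (auto simp: between_mem_segment)
    qed
  qed
qed

section \<open>Points in convex position\<close>

definition side_normal :: "(nat \<Rightarrow> complex) \<Rightarrow> nat \<Rightarrow> nat \<Rightarrow> complex" where
  "side_normal p i j = \<i> * (p j - p i)"

text \<open>
  Positive to the left and negative to the right of the directed line from \<open>p i\<close> to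
  \<open>p j\<close>. Written with an inner product, its sign conditions are halfspaces.
\<close>

definition side :: "(nat \<Rightarrow> complex) \<Rightarrow> nat \<Rightarrow> nat \<Rightarrow> complex \<Rightarrow> real" where
  "side p i j z = side_normal p i j \<bullet> z - side_normal p i j \<bullet> p i"

lemma side_eq_Im: "side p i j z = Im (cnj (p j - p i) * (z - p i))"
  by (simp add: side_def side_normal_def inner_complex_def algebra_simps)

lemma side_ends [simp]: "side p i j (p i) = 0" "side p i j (p j) = 0"
  by (simp_all add: side_eq_Im algebra_simps)

lemma side_affine:
  "side p i j ((1 - t) *\<^sub>R x + t *\<^sub>R y) = (1 - t) * side p i j x + t * side p i j y"
  by (simp add: side_def algebra_simps)

lemma on_line_of_side_eq_0:
  assumes "side p i j z = 0" "p i \<noteq> p j"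
  shows "\<exists>t. z = p i + t *\<^sub>R (p j - p i)"
proof -
  define u where "u = p j - p i"
  define t where "t = Re (cnj u * (z - p i)) / (cmod u)\<^sup>2"
  have "u \<noteq> 0" using assms(2) by (simp add: u_def)
  have "cnj u * (z - p i) = of_real (Re (cnj u * (z - p i)))"
    using assms(1) by (simp add: side_eq_Im u_def complex_eq_iff)
  then have "(u * cnj u) * (z - p i) = of_real (Re (cnj u * (z - p i))) * u"
    by (metis mult.commute mult.left_commute)
  then have "z - p i = t *\<^sub>R u"
    using \<open>u \<noteq> 0\<close> by (simp add: t_def complex_norm_square[symmetric] scaleR_conv_of_real field_simps)
  then show ?thesis unfolding u_def by (intro exI[of _ t]) (simp add: algebra_simps)
qed

text \<open>
  The vertices \<open>a, \<dots>, b\<close> form a polygon of their own, whose top edge \<open>(a,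
  b)\<close> is not among its chords.
\<close>

definition chords_between :: "nat \<Rightarrow> nat \<Rightarrow> (nat \<times> nat) set" where
  "chords_between a b = {(i, j). a \<le> i \<and> i + 1 < j \<and> j \<le> b \<and> (i, j) \<noteq> (a, b)}"

text \<open>
  The chords added when subpolygons are glued to a triangle: a side of the triangle is not a chord
  if it is already a side of the polygon.
\<close>

definition base_chord :: "nat \<Rightarrow> nat \<Rightarrow> (nat \<times> nat) set" where
  "base_chord i j = (if i + 1 < j then {(i, j)} else {})"

definition cells :: "(nat \<Rightarrow> complex) \<Rightarrow> nat \<Rightarrow> nat \<Rightarrow> (nat \<times> nat) set \<Rightarrow> complex set set" where
  "cells p a b T = components (interior (convex hull (p ` {a..b})) - (\<Union>c\<in>T. chord_segment p c))"

lemma finite_chords_between: "finite (chords_between a b)"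
  by (rule finite_subset[of _ "{..b} \<times> {..b}"]) (auto simp: chords_between_def)

lemma closed_chords: "finite T \<Longrightarrow> closed (\<Union>c\<in>T. chord_segment p c)"
  by (auto simp: chord_segment_def)

locale convex_vertices =
  fixes n :: nat and p :: "nat \<Rightarrow> complex"
  assumes ccw: "\<And>i j k. i < j \<Longrightarrow> j < k \<Longrightarrow> k < n \<Longrightarrow> ccw (p i) (p j) (p k)"
    and inj: "inj_on p {..<n}"
begin

lemma p_eq_iff: "i < n \<Longrightarrow> j < n \<Longrightarrow> p i = p j \<longleftrightarrow> i = j"
  using inj by (auto simp: inj_on_def)

lemma side_pos:
  assumes "i < j" "j < n" "k < n" "k < i \<or> j < k"
  shows "side p i j (p k) > 0"
  using ccw[of i j k] ccw[of k i j] assms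
  by (auto simp: side_eq_Im ccw_def algebra_simps)

lemma side_neg:
  assumes "i < k" "k < j" "j < n"
  shows "side p i j (p k) < 0"
  using ccw[of i k j] assms by (auto simp: side_eq_Im ccw_def algebra_simps)

lemma side_normal_nonzero: "i < j \<Longrightarrow> j < n \<Longrightarrow> side_normal p i j \<noteq> 0"
  by (simp add: side_normal_def p_eq_iff)

text \<open>
  With at least three vertices, the sum of the inner normals of the two sides at a vertex gives the
  supporting line: at every other vertex both summands are nonnegative and at least one is positive.
\<close>

lemma vertex_support:
  assumes "i < n"
  shows "\<exists>d. \<forall>k<n. k \<noteq> i \<longrightarrow> d \<bullet> p i < d \<bullet> p k"
proof -
  consider "n = 1" | "n = 2" | "n \<ge> 3" using assms by linarith
  then show ?thesis
  proof cases
    case 1 then show ?thesis using assms by auto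
  next
    case 2
    define d where "d = p (1 - i) - p i"
    have "1 - i < n" "1 - i \<noteq> i" using 2 assms by arith+
    then have "d \<noteq> 0" using assms by (simp add: d_def p_eq_iff)
    moreover have "k = 1 - i" if "k < n" "k \<noteq> i" for k using that 2 assms by auto
    ultimately have "\<forall>k<n. k \<noteq> i \<longrightarrow> d \<bullet> (p k - p i) > 0"
      by (auto simp: d_def)
    then show ?thesis by (auto simp: inner_diff_right)
  next
    case 3
    define d where "d = (if i = 0 then side_normal p 0 1 - side_normal p 0 (n - 1)
       else if i = n - 1 then side_normal p (n - 2) (n - 1) - side_normal p 0 (n - 1)
       else side_normal p (i - 1) i + side_normal p i (i + 1))"
    have "d \<bullet> p k - d \<bullet> p i > 0" if k: "k < n" "k \<noteq> i" for k
    proof -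
      have adj: "side p j (j+1) (p k) > 0 \<or> k \<in> {j,j+1}" if "j + 1 < n" for j
        using side_pos[of j "j+1" k] that k by force
      have top: "side p 0 (n - 1) (p k) < 0 \<or> k = 0 \<or> k = n - 1"
        using side_neg[of 0 k "n - 1"] k by force
      have e: "side_normal p l i \<bullet> p i = side_normal p l i \<bullet> p l" for l
        by (metis side_ends(2) side_def eq_iff_diff_eq_0)
      consider "i = 0" | "i = n - 1" "i \<noteq> 0" | "0 < i" "i < n - 1" using assms by linarith
      then show ?thesis
      proof cases
        case 1
        then have "d \<bullet> p k - d \<bullet> p i = side p 0 1 (p k) - side p 0 (n - 1) (p k)"
          by (simp add: d_def side_def algebra_simps)
        moreover have "side p 0 1 (p k) > 0 \<or> k = 1" using adj[of 0] 1 3 k by auto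
        ultimately show ?thesis using top 1 3 k by auto
      next
        case 2
        then have "d \<bullet> p k - d \<bullet> p i = side p (n - 2) (n - 1) (p k) - side p 0 (n - 1) (p k)"
          using e[of 0] e[of "n - 2"] by (simp add: d_def side_def algebra_simps)
        moreover have "n - 2 + 1 = n - 1" using 3 by simp
        then have "side p (n - 2) (n - 1) (p k) > 0 \<or> k = n - 2"
          using adj[of "n - 2"] 2 3 k by auto
        ultimately show ?thesis using top 2 3 k by auto
      next
        case 3
        then have "d \<bullet> p k - d \<bullet> p i = side p (i - 1) i (p k) + side p i (i + 1) (p k)"
          using e[of "i - 1"] by (simp add: d_def side_def algebra_simps)
        moreover have "side p (i - 1) i (p k) > 0 \<or> k = i - 1" using adj[of "i - 1"] 3 k by auto
        moreover have "side p i (i + 1) (p k) > 0 \<or> k = i + 1" using adj[of i] 3 k by auto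
        ultimately show ?thesis using 3 by auto
      qed
    qed
    then show ?thesis by force
  qed
qed

lemma vertex_support_hull:
  assumes "i < n"
  obtains d where "d \<noteq> 0" "\<And>k. k < n \<Longrightarrow> k \<noteq> i \<Longrightarrow> d \<bullet> p i < d \<bullet> p k"
    "\<And>A. A \<subseteq> {..<n} \<Longrightarrow> convex hull (p ` A) \<subseteq> {x. d \<bullet> x \<ge> d \<bullet> p i}"
proof -
  obtain d where d: "\<forall>k<n. k \<noteq> i \<longrightarrow> d \<bullet> p i < d \<bullet> p k"
    using vertex_support[OF assms] by blast
  have "\<exists>d. d \<noteq> 0 \<and> (\<forall>k<n. k \<noteq> i \<longrightarrow> d \<bullet> p i < d \<bullet> p k)"
  proof (cases "d = 0")
    case True
    \<comment> \<open>Only possible if there is no other vertex, and then any direction will do.\<close>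
    then show ?thesis using d by (intro exI[of _ 1]) auto
  qed (use d in blast)
  then obtain d where d: "d \<noteq> 0" "\<And>k. k < n \<Longrightarrow> k \<noteq> i \<Longrightarrow> d \<bullet> p i < d \<bullet> p k" by blast
  have "convex hull (p ` A) \<subseteq> {x. d \<bullet> x \<ge> d \<bullet> p i}" if "A \<subseteq> {..<n}" for A
  proof (rule hull_minimal)
    show "p ` A \<subseteq> {x. d \<bullet> x \<ge> d \<bullet> p i}"
    proof clarify
      fix k assume "k \<in> A"
      then show "d \<bullet> p k \<ge> d \<bullet> p i" using d(2)[of k] that by (cases "k = i") auto
    qed
  qed (rule convex_halfspace_ge)
  with d that show thesis by blast
qed

lemma vertex_in_hull:
  assumes "i < n" "B \<subseteq> {..<n}" "p i \<in> convex hull (p ` B)"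
  shows "i \<in> B"
proof (rule ccontr)
  assume "i \<notin> B"
  obtain d where d: "\<And>k. k < n \<Longrightarrow> k \<noteq> i \<Longrightarrow> d \<bullet> p i < d \<bullet> p k"
    using vertex_support[OF assms(1)] by blast
  have "convex hull (p ` B) \<subseteq> {x. d \<bullet> x > d \<bullet> p i}"
    using d assms(2) \<open>i \<notin> B\<close> by (intro hull_minimal) (auto simp: convex_halfspace_gt)
  then show False using assms(3) by auto
qed

lemma vertex_notin_interior_hull:
  assumes "i < n" "B \<subseteq> {..<n}"
  shows "p i \<notin> interior (convex hull (p ` B))"
proof -
  obtain d where d: "d \<noteq> 0" "convex hull (p ` B) \<subseteq> {x. d \<bullet> x \<ge> d \<bullet> p i}"
    using vertex_support_hull[OF assms(1)] assms(2) by metis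
  then have "interior (convex hull (p ` B)) \<subseteq> {x. d \<bullet> x > d \<bullet> p i}"
    using interior_mono[OF d(2)] by simp
  then show ?thesis by auto
qed

text \<open>
  The supporting lines at \<open>p i\<close> and at \<open>p j\<close> keep the points of the hull
  from lying beyond either end of the segment.
\<close>

lemma hull_on_line:
  assumes "i < j" "j < n" "A \<subseteq> {..<n}" "z \<in> convex hull (p ` A)" "side p i j z = 0"
  shows "z \<in> closed_segment (p i) (p j)"
proof -
  have pij: "p i \<noteq> p j" using assms by (simp add: p_eq_iff)
  obtain t where t: "z = p i + t *\<^sub>R (p j - p i)"
    using on_line_of_side_eq_0[OF assms(5) pij] by blast
  have "i < n" using assms by simp
  from vertex_support_hull[OF this] obtain d where
    d: "\<And>k. k < n \<Longrightarrow> k \<noteq> i \<Longrightarrow> d \<bullet> p i < d \<bullet> p k"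
       "\<And>A. A \<subseteq> {..<n} \<Longrightarrow> convex hull (p ` A) \<subseteq> {x. d \<bullet> x \<ge> d \<bullet> p i}"
    by metis
  have d: "d \<bullet> p i < d \<bullet> p j" "d \<bullet> p i \<le> d \<bullet> z"
    using d(1)[of j] d(2)[OF assms(3)] assms by auto
  have "0 \<le> t * (d \<bullet> (p j - p i))" using d t by (simp add: algebra_simps)
  moreover have "d \<bullet> (p j - p i) > 0" using d by (simp add: algebra_simps)
  ultimately have t0: "0 \<le> t" by (simp add: zero_le_mult_iff)
  have "j < n" using assms by simp
  from vertex_support_hull[OF this] obtain e where
    e: "\<And>k. k < n \<Longrightarrow> k \<noteq> j \<Longrightarrow> e \<bullet> p j < e \<bullet> p k"
       "\<And>A. A \<subseteq> {..<n} \<Longrightarrow> convex hull (p ` A) \<subseteq> {x. e \<bullet> x \<ge> e \<bullet> p j}"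
    by metis
  have e: "e \<bullet> p j < e \<bullet> p i" "e \<bullet> p j \<le> e \<bullet> z"
    using e(1)[of i] e(2)[OF assms(3)] assms by auto
  have "0 \<le> (1 - t) * (e \<bullet> (p i - p j))" using e t by (simp add: algebra_simps)
  moreover have "e \<bullet> (p i - p j) > 0" using e by (simp add: algebra_simps)
  ultimately have t1: "t \<le> 1" by (simp add: zero_le_mult_iff)
  show ?thesis unfolding in_segment
    using t t0 t1 by (intro exI[of _ t]) (simp add: algebra_simps)
qed

lemma side_0_on_segment: "z \<in> closed_segment (p i) (p j) \<Longrightarrow> side p i j z = 0"
  by (auto simp: in_segment side_affine)

text \<open>
  By \<open>hull_on_line\<close>, all that the hull has on the line is the segment between the two
  vertices, and this segment belongs to both parts.
\<close>

lemma hull_cut: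
  assumes "i < j" "j < n" "A \<subseteq> {..<n}" "i \<in> A" "j \<in> A"
  shows "convex hull (p ` A) \<inter> {z. side p i j z \<le> 0} = convex hull (p ` (A \<inter> {i..j}))"
    and "convex hull (p ` A) \<inter> {z. side p i j z \<ge> 0} = convex hull (p ` (A - {i<..<j}))"
proof -
  let ?w = "side_normal p i j" and ?S1 = "p ` (A \<inter> {i..j})" and ?S2 = "p ` (A - {i<..<j})"
  have S: "?S1 \<union> ?S2 = p ` A" "?S2 \<union> ?S1 = p ` A" by auto
  have line: "convex hull (p ` A) \<inter> {z. side p i j z = 0} \<subseteq> convex hull (p ` B)"
    if "i \<in> B" "j \<in> B" for B
  proof -
    have "p i \<in> convex hull (p ` B)" "p j \<in> convex hull (p ` B)"
      using that by (auto intro: hull_inc)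
    from closed_segment_subset[OF this] show ?thesis
      using hull_on_line[OF assms(1-3)] by auto
  qed
  have le: "side p i j x \<le> 0" if x: "x \<in> ?S1" for x
  proof -
    obtain k where k: "x = p k" "k \<in> A \<inter> {i..j}" using x by blast
    then consider "k = i" | "k = j" | "i < k \<and> k < j" by force
    then show ?thesis using side_neg[of i k j] k assms by cases auto
  qed
  have ge: "side p i j x \<ge> 0" if x: "x \<in> ?S2" for x
  proof -
    obtain k where k: "x = p k" "k < n" "k \<le> i \<or> j \<le> k" using x assms(3) by force
    then consider "k = i" | "k = j" | "k < i \<or> j < k" by linarith
    then show ?thesis using side_pos[of i j k] k assms by cases auto
  qed
  show "convex hull (p ` A) \<inter> {z. side p i j z \<le> 0} = convex hull ?S1"
    using convex_hull_Int_halfspace[of ?S1 ?w "?w \<bullet> p i" ?S2] le ge line[of "A \<inter> {i..j}"] assms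
    unfolding S by (simp add: side_def)
  show "convex hull (p ` A) \<inter> {z. side p i j z \<ge> 0} = convex hull ?S2"
    using convex_hull_Int_halfspace[of ?S2 "- ?w" "- (?w \<bullet> p i)" ?S1] le ge line[of "A - {i<..<j}"] assms
    unfolding S by (simp add: side_def)
qed

lemma interior_hull_cut:
  assumes "i < j" "j < n" "A \<subseteq> {..<n}" "i \<in> A" "j \<in> A"
  shows "interior (convex hull (p ` (A \<inter> {i..j}))) = interior (convex hull (p ` A)) \<inter> {z. side p i j z < 0}"
    and "interior (convex hull (p ` (A - {i<..<j}))) = interior (convex hull (p ` A)) \<inter> {z. side p i j z > 0}"
proof -
  have "interior {z. side p i j z \<le> 0} = {z. side p i j z < 0}"
    using interior_halfspace_le[OF side_normal_nonzero[OF assms(1,2)], of "side_normal p i j \<bullet> p i"]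
    by (simp add: side_def)
  then show "interior (convex hull (p ` (A \<inter> {i..j}))) = interior (convex hull (p ` A)) \<inter> {z. side p i j z < 0}"
    unfolding hull_cut(1)[OF assms, symmetric] by simp
  have "interior {z. side p i j z \<ge> 0} = {z. side p i j z > 0}"
    using interior_halfspace_ge[OF side_normal_nonzero[OF assms(1,2)], of "side_normal p i j \<bullet> p i"]
    by (simp add: side_def)
  then show "interior (convex hull (p ` (A - {i<..<j}))) = interior (convex hull (p ` A)) \<inter> {z. side p i j z > 0}"
    unfolding hull_cut(2)[OF assms, symmetric] by simp
qed

lemma interior_triangle_nonempty:
  assumes "i < j" "j < k" "k < n"
  shows "interior (convex hull (p ` {i, j, k})) \<noteq> {}"
proof -
  have d: "p i \<noteq> p j" "p j \<noteq> p k" "p i \<noteq> p k" using assms by (auto simp: p_eq_iff)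
  have "\<not> collinear {p i, p j, p k}"
  proof
    assume "collinear {p i, p j, p k}"
    then obtain u where u: "\<And>x y. x \<in> {p i, p j, p k} \<Longrightarrow> y \<in> {p i, p j, p k} \<Longrightarrow> \<exists>c. x - y = c *\<^sub>R u"
      unfolding collinear_def by blast
    obtain c where c: "p j - p i = c *\<^sub>R u" using u[of "p j" "p i"] by auto
    obtain e where e: "p k - p i = e *\<^sub>R u" using u[of "p k" "p i"] by auto
    have "Im (cnj (p j - p i) * (p k - p i)) = 0" unfolding c e by simp
    then show False using ccw[OF assms] by (simp add: ccw_def)
  qed
  then have "\<not> affine_dependent {p i, p j, p k}" using d collinear_3_eq_affine_dependent by blast
  then show ?thesis using interior_convex_hull_eq_empty[of "{p i, p j, p k}"] d by auto
qed

lemma side_nonpos: "i < j \<Longrightarrow> j < n \<Longrightarrow> i \<le> k \<Longrightarrow> k \<le> j \<Longrightarrow> side p i j (p k) \<le> 0"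
  using side_neg[of i k j] by (cases "k = i \<or> k = j") auto

lemma side_nonneg: "i < j \<Longrightarrow> j < n \<Longrightarrow> k < n \<Longrightarrow> k \<le> i \<or> j \<le> k \<Longrightarrow> side p i j (p k) \<ge> 0"
  using side_pos[of i j k] by (cases "k = i \<or> k = j") auto

lemma side_zero_iff: "i < j \<Longrightarrow> j < n \<Longrightarrow> k < n \<Longrightarrow> side p i j (p k) = 0 \<longleftrightarrow> k = i \<or> k = j"
  using side_pos[of i j k] side_neg[of i k j]
  by (metis linorder_less_linear order_less_irrefl side_ends)

text \<open>
  For indices that do not interleave, the ends of the second chord lie weakly on one side of the
  first, and not both on its line. The chords can then only meet in a vertex, which is not an
  interior point.
\<close>

lemma noncrossing_chords_disjoint:
  assumes "i < j" "j < n" "k < l" "l < n" "(k, l) \<noteq> (i, j)" "A \<subseteq> {..<n}"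
    and nc: "\<not> (i < k \<and> k < j \<and> j < l)" "\<not> (k < i \<and> i < l \<and> l < j)"
  shows "closed_segment (p i) (p j) \<inter> closed_segment (p k) (p l) \<inter> interior (convex hull (p ` A)) = {}"
proof (rule ccontr)
  assume "\<not> ?thesis"
  then obtain z where z: "z \<in> closed_segment (p i) (p j)" "z \<in> closed_segment (p k) (p l)"
    "z \<in> interior (convex hull (p ` A))" by blast
  let ?f = "side p i j"
  obtain t where t: "0 \<le> t" "t \<le> 1" "z = (1 - t) *\<^sub>R p k + t *\<^sub>R p l"
    using z(2) by (auto simp: in_segment)
  have 0: "(1 - t) * ?f (p k) + t * ?f (p l) = 0"
    using side_0_on_segment[OF z(1)] by (simp add: t(3) side_affine)
  have nv: "z \<noteq> p m" if "m < n" for m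
    using vertex_notin_interior_hull[OF that assms(6)] z(3) by blast
  have "t \<noteq> 0" "t \<noteq> 1" using nv[of k] nv[of l] t(3) assms by auto
  then have t': "1 - t > 0" "t > 0" using t by auto
  consider "i \<le> k" "l \<le> j" | "k \<le> i \<or> j \<le> k" "l \<le> i \<or> j \<le> l"
    using nc assms by linarith
  then have "?f (p k) = 0 \<and> ?f (p l) = 0"
  proof cases
    case 1
    then have "?f (p k) \<le> 0" "?f (p l) \<le> 0" using assms by (auto intro!: side_nonpos)
    then show ?thesis using 0 t'
      by (smt (verit) mult_nonneg_nonpos mult_eq_0_iff)
  next
    case 2
    then have "?f (p k) \<ge> 0" "?f (p l) \<ge> 0" using assms by (auto intro!: side_nonneg)
    then show ?thesis using 0 t'
      by (smt (verit) mult_nonneg_nonneg mult_eq_0_iff)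
  qed
  then show False using side_zero_iff[of i j] assms by auto
qed

lemma hull_side_nonpos:
  assumes "i < j" "j < n" "A \<subseteq> {i..j}"
  shows "convex hull (p ` A) \<subseteq> {z. side p i j z \<le> 0}"
proof -
  have "convex hull (p ` A) \<subseteq> {z. side_normal p i j \<bullet> z \<le> side_normal p i j \<bullet> p i}"
  proof (rule hull_minimal)
    show "p ` A \<subseteq> {z. side_normal p i j \<bullet> z \<le> side_normal p i j \<bullet> p i}"
      using side_nonpos[OF assms(1,2)] assms(3) by (auto simp: side_def)
  qed (rule convex_halfspace_le)
  then show ?thesis by (auto simp: side_def)
qed

lemma hull_side_nonneg:
  assumes "i < j" "j < n" "A \<subseteq> {..<n} - {i<..<j}"
  shows "convex hull (p ` A) \<subseteq> {z. side p i j z \<ge> 0}"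
proof -
  have "convex hull (p ` A) \<subseteq> {z. side_normal p i j \<bullet> z \<ge> side_normal p i j \<bullet> p i}"
  proof (rule hull_minimal)
    show "p ` A \<subseteq> {z. side_normal p i j \<bullet> z \<ge> side_normal p i j \<bullet> p i}"
    proof clarify
      fix k assume "k \<in> A"
      then have "k < n" "k \<le> i \<or> j \<le> k" using assms(3) by force+
      then show "side_normal p i j \<bullet> p k \<ge> side_normal p i j \<bullet> p i"
        using side_nonneg[OF assms(1,2), of k] by (simp add: side_def)
    qed
  qed (rule convex_halfspace_ge)
  then show ?thesis by (auto simp: side_def)
qed

text \<open>
  Cutting along both lower sides of the triangle \<open>a, k, b\<close> describes the interiors of
  the three parts by signs only, which makes their disjointness and openness immediate.
\<close>

lemma interior_parts:
  assumes "a < k" "k < b" "b < n"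
  shows "interior (convex hull (p ` {a..k})) = interior (convex hull (p ` {a..b})) \<inter> {z. side p a k z < 0}" (is ?A)
    and "interior (convex hull (p ` {k..b})) = interior (convex hull (p ` {a..b})) \<inter> {z. side p k b z < 0}" (is ?B)
    and "open_triangle p a k b = interior (convex hull (p ` {a..b})) \<inter> {z. side p a k z > 0} \<inter> {z. side p k b z > 0}" (is ?C)
proof -
  have sub: "{a..b} \<subseteq> {..<n}" using assms by auto
  have e: "{a..b} \<inter> {a..k} = {a..k}" "{a..b} \<inter> {k..b} = {k..b}"
    "{a..b} - {a<..<k} - {k<..<b} = {a, k, b}" using assms by auto
  show ?A ?B
    using interior_hull_cut(1)[of a k "{a..b}"] interior_hull_cut(1)[of k b "{a..b}"] sub assms
    by (simp_all add: e)
  have "{a..b} - {a<..<k} \<subseteq> {..<n}" "k \<in> {a..b} - {a<..<k}" "b \<in> {a..b} - {a<..<k}"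
    using sub assms by auto
  then have "interior (convex hull (p ` {a, k, b})) =
    interior (convex hull (p ` ({a..b} - {a<..<k}))) \<inter> {z. side p k b z > 0}"
    using interior_hull_cut(2)[of k b "{a..b} - {a<..<k}"] assms unfolding e by blast
  also have "interior (convex hull (p ` ({a..b} - {a<..<k}))) =
    interior (convex hull (p ` {a..b})) \<inter> {z. side p a k z > 0}"
    using interior_hull_cut(2)[of a k "{a..b}"] sub assms by auto
  finally show ?C by (simp add: open_triangle_def)
qed

text \<open>
  Lines through two adjacent vertices avoid the interior, so this covers both the sides and the
  chords among the sides of the top triangle.
\<close>

lemma interior_on_chord_line:
  assumes "a \<le> i" "i < j" "j \<le> b" "b < n" "z \<in> interior (convex hull (p ` {a..b}))" "side p i j z = 0"
  shows "i + 1 < j \<and> z \<in> closed_segment (p i) (p j)"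
proof
  have sub: "{a..b} \<subseteq> {..<n}" using assms by auto
  show "z \<in> closed_segment (p i) (p j)"
    using hull_on_line[of i j "{a..b}" z] sub assms interior_subset[of "convex hull (p ` {a..b})"] by auto
  show "i + 1 < j"
  proof (rule ccontr)
    assume "\<not> i + 1 < j"
    then have e: "{a..b} - {i<..<j} = {a..b}" using assms by auto
    have "interior (convex hull (p ` ({a..b} - {i<..<j})))
        = interior (convex hull (p ` {a..b})) \<inter> {z. side p i j z > 0}"
      using assms sub by (intro interior_hull_cut(2)) auto
    then have "z \<in> {z. side p i j z > 0}" using assms(5) unfolding e by blast
    then show False using assms(6) by simp
  qed
qed

section \<open>Gluing two dissected polygons to a triangle\<close>

lemma chord_segments_subset:
  assumes "T \<subseteq> chords_between a b"
  shows "(\<Union>c\<in>T. chord_segment p c) \<subseteq> convex hull (p ` {a..b})"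
proof -
  have "closed_segment (p i) (p j) \<subseteq> convex hull (p ` {a..b})" if "(i, j) \<in> T" for i j
    using that assms by (intro closed_segment_subset hull_inc) (auto simp: chords_between_def)
  then show ?thesis by (force simp: chord_segment_def)
qed

lemma open_triangle_facts:
  assumes "a < k" "k < b" "b < n"
  shows "open (open_triangle p a k b)" "connected (open_triangle p a k b)" "open_triangle p a k b \<noteq> {}"
    "closure (open_triangle p a k b) = convex hull (p ` {a, k, b})"
proof -
  have ne: "interior (convex hull (p ` {a, k, b})) \<noteq> {}"
    by (rule interior_triangle_nonempty[OF assms])
  have e: "open_triangle p a k b = interior (convex hull (p ` {a, k, b}))"
    by (simp add: open_triangle_def)
  show "open (open_triangle p a k b)" by (simp add: e)
  show "connected (open_triangle p a k b)" unfolding e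
    by (intro convex_connected convex_interior convex_convex_hull)
  show "open_triangle p a k b \<noteq> {}" unfolding e by (rule ne)
  have "closure (interior (convex hull (p ` {a, k, b}))) = closure (convex hull (p ` {a, k, b}))"
    by (rule convex_closure_interior[OF convex_convex_hull ne])
  also have "\<dots> = convex hull (p ` {a, k, b})"
    by (intro closure_closed compact_imp_closed finite_imp_compact_convex_hull) auto
  finally show "closure (open_triangle p a k b) = convex hull (p ` {a, k, b})" unfolding e .
qed

text \<open>
  The signs relative to the lines \<open>a k\<close> and \<open>k b\<close> sort the remaining
  interior points into the triangle and the two subpolygons, and each chord of a subpolygon stays
  out of the other two parts. So the space splits into three disjoint open sets.
\<close>

lemma cells_glue:
  assumes k: "a < k" "k < b" "b < n" and T: "T1 \<subseteq> chords_between a k" "T2 \<subseteq> chords_between k b"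
  shows "cells p a b (T1 \<union> T2 \<union> base_chord a k \<union> base_chord k b) =
    insert (open_triangle p a k b) (cells p a k T1 \<union> cells p k b T2)"
proof -
  define I where "I = interior (convex hull (p ` {a..b}))"
  define I1 where "I1 = interior (convex hull (p ` {a..k}))"
  define I2 where "I2 = interior (convex hull (p ` {k..b}))"
  define C1 where "C1 = (\<Union>c\<in>T1. chord_segment p c)"
  define C2 where "C2 = (\<Union>c\<in>T2. chord_segment p c)"
  define E where "E = (\<Union>c\<in>base_chord a k \<union> base_chord k b. chord_segment p c)"
  define M where "M = open_triangle p a k b"
  define f where "f = side p a k"
  define g where "g = side p k b"
  have kn: "k < n" using k by simp
  have parts: "I1 = I \<inter> {z. f z < 0}" "I2 = I \<inter> {z. g z < 0}" "M = I \<inter> {z. f z > 0} \<inter> {z. g z > 0}"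
    using interior_parts[OF k] by (simp_all add: I_def I1_def I2_def M_def f_def g_def)
  have P1: "convex hull (p ` {a..k}) \<subseteq> {z. f z \<le> 0}" "convex hull (p ` {a..k}) \<subseteq> {z. g z \<ge> 0}"
    unfolding f_def g_def using hull_side_nonpos[of a k "{a..k}"] hull_side_nonneg[of k b "{a..k}"] k kn by force+
  have P2: "convex hull (p ` {k..b}) \<subseteq> {z. g z \<le> 0}" "convex hull (p ` {k..b}) \<subseteq> {z. f z \<ge> 0}"
    unfolding f_def g_def using hull_side_nonpos[of k b "{k..b}"] hull_side_nonneg[of a k "{k..b}"] k kn by force+
  have C1: "f z \<le> 0" "g z \<ge> 0" if "z \<in> C1" for z
    using that chord_segments_subset[OF T(1)] P1 unfolding C1_def by blast+
  have C2: "g z \<le> 0" "f z \<ge> 0" if "z \<in> C2" for z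
    using that chord_segments_subset[OF T(2)] P2 unfolding C2_def by blast+
  have I1: "f z \<le> 0" "g z \<ge> 0" if "z \<in> I1" for z
    using that interior_subset P1 unfolding I1_def by blast+
  have I2: "g z \<le> 0" "f z \<ge> 0" if "z \<in> I2" for z
    using that interior_subset P2 unfolding I2_def by blast+
  have "closed_segment (p a) (p k) \<subseteq> convex hull (p ` {a..k})"
    using k by (simp_all add: closed_segment_subset hull_inc)
  then have segs1: "f z = 0 \<and> g z \<ge> 0" if "z \<in> closed_segment (p a) (p k)" for z
    using that P1(2) side_0_on_segment[of z a k] by (auto simp: f_def)
  have "closed_segment (p k) (p b) \<subseteq> convex hull (p ` {k..b})"
    using k by (simp add: closed_segment_subset hull_inc)
  then have segs2: "g z = 0 \<and> f z \<ge> 0" if "z \<in> closed_segment (p k) (p b)" for z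
    using that P2(2) side_0_on_segment[of z k b] by (auto simp: g_def)
  have E: "f z = 0 \<and> g z \<ge> 0 \<or> g z = 0 \<and> f z \<ge> 0" if "z \<in> E" for z
    using that segs1[of z] segs2[of z]
    by (auto simp: E_def base_chord_def chord_segment_def split: if_splits)
  \<comment> \<open>A side of the polygon contributes nothing to \<open>E\<close>, but its line contains no interior point either.\<close>
  have E2: "z \<in> E" if "z \<in> I" "f z = 0 \<or> g z = 0" for z
    using that interior_on_chord_line[of a a k b z] interior_on_chord_line[of a k b b z] k
    by (auto simp: E_def base_chord_def chord_segment_def f_def g_def I_def)
  have U: "I - (\<Union>c\<in>T1 \<union> T2 \<union> base_chord a k \<union> base_chord k b. chord_segment p c)
     = M \<union> ((I1 - C1) \<union> (I2 - C2))" (is "I - ?C = ?R")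
  proof -
    have C: "?C = C1 \<union> C2 \<union> E" by (auto simp: C1_def C2_def E_def)
    show ?thesis
    proof (intro set_eqI iffI)
      fix z assume "z \<in> I - ?C"
      then have z: "z \<in> I" "z \<notin> C1" "z \<notin> C2" "f z \<noteq> 0" "g z \<noteq> 0" using E2 C by blast+
      then show "z \<in> ?R" unfolding parts by auto
    next
      fix z assume "z \<in> ?R"
      then consider "z \<in> M" | "z \<in> I1 - C1" | "z \<in> I2 - C2" by blast
      then show "z \<in> I - ?C" unfolding C
      proof cases
        case 1
        then show "z \<in> I - (C1 \<union> C2 \<union> E)" using C1[of z] C2[of z] E[of z] unfolding parts by auto
      next
        case 2
        then show "z \<in> I - (C1 \<union> C2 \<union> E)" using I1[of z] C2[of z] E[of z] unfolding parts by auto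
      next
        case 3
        then show "z \<in> I - (C1 \<union> C2 \<union> E)" using I2[of z] C1[of z] E[of z] unfolding parts by auto
      qed
    qed
  qed
  have op: "open M" "open (I1 - C1)" "open (I2 - C2)"
    using open_triangle_facts(1)[OF k] closed_chords finite_subset[OF T(1) finite_chords_between]
      finite_subset[OF T(2) finite_chords_between]
    by (auto simp: M_def I1_def I2_def C1_def C2_def intro!: open_Diff)
  have dis: "M \<inter> ((I1 - C1) \<union> (I2 - C2)) = {}" "(I1 - C1) \<inter> (I2 - C2) = {}"
  proof -
    show "M \<inter> ((I1 - C1) \<union> (I2 - C2)) = {}" unfolding parts by auto
    have "False" if "z \<in> I1" "z \<in> I2" for z
      using I1(2)[OF that(1)] that(2) unfolding parts by auto
    then show "(I1 - C1) \<inter> (I2 - C2) = {}" by blast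
  qed
  have "components (M \<union> ((I1 - C1) \<union> (I2 - C2))) = components M \<union> (components (I1 - C1) \<union> components (I2 - C2))"
    using op dis by (metis components_Un_disjoint_open open_Un)
  moreover have "components M = {M}"
    using open_triangle_facts(2,3)[OF k] by (simp add: M_def components_eq_sing_iff)
  ultimately show ?thesis
    unfolding cells_def I_def[symmetric] U
    by (simp add: I1_def I2_def C1_def C2_def M_def)
qed

section \<open>The triangle on the base edge\<close>

lemma open_triangle_subset_hullD:
  assumes "i < j" "j < k" "k < n" "B \<subseteq> {..<n}" "open_triangle p i j k \<subseteq> convex hull (p ` B)"
  shows "{i, j, k} \<subseteq> B"
proof -
  have "finite B" using assms(4) finite_subset by blast
  then have "closed (convex hull (p ` B))"
    by (intro compact_imp_closed finite_imp_compact_convex_hull) auto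
  then have "closure (open_triangle p i j k) \<subseteq> convex hull (p ` B)"
    using assms(5) by (rule closure_minimal[rotated])
  then have sub: "convex hull (p ` {i, j, k}) \<subseteq> convex hull (p ` B)"
    using open_triangle_facts(4)[OF assms(1-3)] by simp
  have "l \<in> B" if "l \<in> {i, j, k}" for l
  proof (rule vertex_in_hull)
    show "l < n" using that assms by auto
    show "p l \<in> convex hull (p ` B)"
      using that sub by (meson hull_inc imageI subsetD)
  qed (rule assms(4))
  then show ?thesis by blast
qed

lemma open_triangle_eqD:
  assumes "i < j" "j < k" "k < n" "i' < j'" "j' < k'" "k' < n"
    and e: "open_triangle p i j k = open_triangle p i' j' k'"
  shows "i = i' \<and> j = j' \<and> k = k'"
proof -
  have "open_triangle p i j k \<subseteq> convex hull {p i', p j', p k'}"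
    unfolding e unfolding open_triangle_def by (rule interior_subset)
  then have "{i, j, k} \<subseteq> {i', j', k'}"
    using open_triangle_subset_hullD[of i j k "{i', j', k'}"] assms(1-6) by simp
  then show ?thesis using assms by auto
qed

lemma midpoint_not_vertex:
  assumes "a < b" "b < n" "a \<le> l" "l \<le> b"
  shows "midpoint (p a) (p b) \<noteq> p l"
proof
  assume e: "midpoint (p a) (p b) = p l"
  have "midpoint (p a) (p b) \<in> closed_segment (p a) (p b)" by simp
  then have "side p a b (p l) = 0" using side_0_on_segment e by metis
  then have "l = a \<or> l = b" using side_zero_iff[of a b l] assms by auto
  then show False using e p_eq_iff[of a b] assms by (auto simp: midpoint_eq_endpoint)
qed

lemma midpoint_not_on_chord:
  assumes "a < b" "b < n" "(i, j) \<in> chords_between a b"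
  shows "midpoint (p a) (p b) \<notin> closed_segment (p i) (p j)"
proof
  let ?m = "midpoint (p a) (p b)"
  let ?f = "side p a b"
  assume "?m \<in> closed_segment (p i) (p j)"
  then obtain t where t: "0 \<le> t" "t \<le> 1" "?m = (1 - t) *\<^sub>R p i + t *\<^sub>R p j"
    by (auto simp: in_segment)
  have ij: "a \<le> i" "i < j" "j \<le> b" "(i, j) \<noteq> (a, b)" using assms(3) by (auto simp: chords_between_def)
  have "?f ?m = 0" by (rule side_0_on_segment) simp
  then have 0: "(1 - t) * ?f (p i) + t * ?f (p j) = 0" by (simp add: t(3) side_affine)
  have "t \<noteq> 0" using midpoint_not_vertex[of a b i] t(3) assms ij by auto
  moreover have "t \<noteq> 1" using midpoint_not_vertex[of a b j] t(3) assms ij by auto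
  moreover have "?f (p i) \<le> 0" "?f (p j) \<le> 0" using ij assms by (auto intro!: side_nonpos)
  ultimately have "?f (p i) = 0 \<and> ?f (p j) = 0" using 0 t(1,2)
    by (smt (verit) mult_nonneg_nonpos mult_eq_0_iff)
  then show False using side_zero_iff[of a b] ij assms by auto
qed

lemma interior_polygon_nonempty:
  assumes "a + 1 < b" "b < n"
  shows "interior (convex hull (p ` {a..b})) \<noteq> {}"
proof -
  have "interior (convex hull (p ` {a, a + 1, b})) \<subseteq> interior (convex hull (p ` {a..b}))"
    using assms by (intro interior_mono hull_mono) auto
  then show ?thesis using interior_triangle_nonempty[of a "a + 1" b] assms by auto
qed

text \<open>
  The base midpoint is on no chord, so a small disc around it avoids all of them. The part of the
  disc inside the polygon is convex, hence within one cell.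
\<close>

lemma exists_top_cell:
  assumes "a + 1 < b" "b < n" "T \<subseteq> chords_between a b"
  shows "\<exists>R \<in> cells p a b T. midpoint (p a) (p b) \<in> closure R"
proof -
  define I where "I = interior (convex hull (p ` {a..b}))"
  define C where "C = (\<Union>c\<in>T. chord_segment p c)"
  define m where "m = midpoint (p a) (p b)"
  have "closed C" unfolding C_def using closed_chords finite_subset[OF assms(3) finite_chords_between] by blast
  moreover have "m \<notin> C"
    using midpoint_not_on_chord[of a b] assms by (fastforce simp: C_def m_def chord_segment_def)
  ultimately obtain e where e: "e > 0" "ball m e \<subseteq> - C"
    by (metis ComplI open_Compl open_contains_ball)
  have "m \<in> convex hull (p ` {a..b})"
  proof -
    have "closed_segment (p a) (p b) \<subseteq> convex hull (p ` {a..b})"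
      using assms by (simp add: closed_segment_subset hull_inc)
    then show ?thesis by (auto simp: m_def)
  qed
  then have "m \<in> closure I"
    using convex_closure_interior[OF convex_convex_hull interior_polygon_nonempty[OF assms(1,2)]]
      closure_subset unfolding I_def by blast
  then have m: "m \<in> closure (ball m e \<inter> I)"
    using open_Int_closure_subset[of "ball m e" I] e(1) by auto
  then have "ball m e \<inter> I \<noteq> {}" by force
  moreover have "connected (ball m e \<inter> I)"
    unfolding I_def by (intro convex_connected convex_Int convex_interior convex_convex_hull convex_ball)
  moreover have "ball m e \<inter> I \<subseteq> I - C" using e(2) by blast
  ultimately obtain R where "R \<in> components (I - C)" "ball m e \<inter> I \<subseteq> R"
    using exists_component_superset[of "ball m e \<inter> I" "I - C"] by blast
  then show ?thesis
    using m closure_mono[of "ball m e \<inter> I" R] by (auto simp: cells_def I_def C_def m_def)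
qed

text \<open>
  The midpoint of the base is a convex combination of the vertices of the triangle, all of which lie
  weakly on one side of the line through the base. So only vertices on that line contribute, and one
  of them alone cannot give the midpoint.
\<close>

lemma triangle_at_base:
  assumes "a < b" "b < n" "i < j" "j < k" "k < n"
    and sub: "open_triangle p i j k \<subseteq> convex hull (p ` {a..b})"
    and m: "midpoint (p a) (p b) \<in> closure (open_triangle p i j k)"
  shows "i = a \<and> k = b"
proof -
  let ?m = "midpoint (p a) (p b)"
  let ?f = "side p a b"
  have "{i, j, k} \<subseteq> {a..b}" using assms by (intro open_triangle_subset_hullD) auto
  then have r: "a \<le> i" "k \<le> b" by auto
  have "?m \<in> convex hull {p i, p j, p k}"
    using m open_triangle_facts(4)[of i j k] assms by simp
  then obtain u v w where u: "?m = u *\<^sub>R p i + v *\<^sub>R p j + w *\<^sub>R p k" "0 \<le> u" "0 \<le> v" "0 \<le> w" "u + v + w = 1"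
    by (auto simp: convex_hull_3)
  have "?f ?m = 0" by (rule side_0_on_segment) simp
  moreover have "?f ?m = u * ?f (p i) + v * ?f (p j) + w * ?f (p k)"
  proof -
    have "side_normal p a b \<bullet> p a = (u + v + w) * (side_normal p a b \<bullet> p a)" using u(5) by simp
    then show ?thesis unfolding u(1) side_def by (simp add: algebra_simps)
  qed
  ultimately have 0: "u * ?f (p i) + v * ?f (p j) + w * ?f (p k) = 0" by simp
  have j: "?f (p j) < 0" using r assms by (intro side_neg) auto
  have ik: "?f (p i) \<le> 0" "?f (p k) \<le> 0" using r assms by (auto intro!: side_nonpos)
  have le: "u * ?f (p i) \<le> 0" "v * ?f (p j) \<le> 0" "w * ?f (p k) \<le> 0"
    using u j ik by (auto simp: mult_nonneg_nonpos)
  then have z: "u * ?f (p i) = 0" "v * ?f (p j) = 0" "w * ?f (p k) = 0" using 0 by linarith+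
  then have v: "v = 0" using j by simp
  have "u \<noteq> 1" "w \<noteq> 1"
    using midpoint_not_vertex[of a b i] midpoint_not_vertex[of a b k] u v r assms by auto
  then have "u \<noteq> 0" "w \<noteq> 0" using u(5) v by auto
  then have "?f (p i) = 0" "?f (p k) = 0" using z by auto
  then show ?thesis using side_zero_iff[of a b i] side_zero_iff[of a b k] r assms by auto
qed

text \<open>
  The triangle is connected and misses the chord, so it lies on one side of the chord. But a chord
  running past \<open>k\<close> has the vertex \<open>k\<close> strictly on one side and
  \<open>a\<close> or \<open>b\<close> strictly on the other.
\<close>

lemma chord_not_across_cell:
  assumes k: "a < k" "k < b" "b < n" and T: "T \<subseteq> chords_between a b"
    and cell: "open_triangle p a k b \<in> cells p a b T"
    and xy: "(x, y) \<in> T"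
  shows "\<not> (x < k \<and> k < y)"
proof
  assume xk: "x < k \<and> k < y"
  let ?f = "side p x y"
  let ?M = "open_triangle p a k b"
  have M: "?M \<subseteq> interior (convex hull (p ` {a..b})) - (\<Union>c\<in>T. chord_segment p c)"
    using cell unfolding cells_def by (rule in_components_subset)
  have r: "a \<le> x" "y \<le> b" "(x, y) \<noteq> (a, b)" "x < y" "y < n" using T xy k by (auto simp: chords_between_def)
  have nz: "?f z \<noteq> 0" if "z \<in> ?M" for z
  proof
    assume "?f z = 0"
    moreover have "z \<in> convex hull (p ` {a..b})" using that M interior_subset by blast
    ultimately have "z \<in> closed_segment (p x) (p y)"
      using r k by (intro hull_on_line[of x y "{a..b}" z]) auto
    then show False using that M xy by (force simp: chord_segment_def)
  qed
  have conn: "connected ?M" by (rule open_triangle_facts(2)[OF k])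
  have hl: "{z. ?f z \<le> 0} = {z. side_normal p x y \<bullet> z \<le> side_normal p x y \<bullet> p x}"
    "{z. ?f z \<ge> 0} = {z. side_normal p x y \<bullet> z \<ge> side_normal p x y \<bullet> p x}"
    by (auto simp: side_def)
  have cl: "closed {z. ?f z \<le> 0}" "closed {z. ?f z \<ge> 0}"
    unfolding hl by (rule closed_halfspace_le closed_halfspace_ge)+
  have "?M \<subseteq> {z. ?f z \<le> 0} \<or> ?M \<subseteq> {z. ?f z \<ge> 0}"
  proof (rule ccontr)
    assume "\<not> ?thesis"
    then obtain z1 z2 where "z1 \<in> ?M" "z2 \<in> ?M" "?f z1 \<ge> 0" "?f z2 \<le> 0" by fastforce
    then have "\<exists>z\<in>?M. side_normal p x y \<bullet> z = side_normal p x y \<bullet> p x"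
      using connected_ivt_hyperplane[OF conn, of z2 z1 "side_normal p x y" "side_normal p x y \<bullet> p x"]
      by (auto simp: side_def)
    then show False using nz by (auto simp: side_def)
  qed
  then have "closure ?M \<subseteq> {z. ?f z \<le> 0} \<or> closure ?M \<subseteq> {z. ?f z \<ge> 0}"
    using cl by (metis closure_minimal)
  moreover have "p l \<in> closure ?M" if "l \<in> {a, k, b}" for l
    unfolding open_triangle_facts(4)[OF k] using that by (intro hull_inc) auto
  then have "p a \<in> closure ?M" "p k \<in> closure ?M" "p b \<in> closure ?M" by auto
  moreover have "?f (p k) < 0" using xk r by (intro side_neg) auto
  ultimately have "?f (p a) \<le> 0" "?f (p b) \<le> 0" by auto
  moreover have "?f (p a) > 0" if "a \<noteq> x" using that r k by (intro side_pos) auto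
  moreover have "?f (p b) > 0" if "b \<noteq> y" using that r k by (intro side_pos) auto
  ultimately show False using r by force
qed

text \<open>
  The side \<open>(i, j)\<close> of the triangle passes through a point \<open>w\<close> of the
  interior of the polygon. This point is in the closure of the cell but not in the cell. As
  components are relatively closed, \<open>w\<close> must be on a chord, and only the chord
  \<open>(i, j)\<close> itself can pass there without crossing the triangle.
\<close>

lemma base_chord_of_cell:
  assumes k: "a < k" "k < b" "b < n" and T: "T \<subseteq> chords_between a b"
    and cell: "open_triangle p a k b \<in> cells p a b T"
    and ij: "(i, j) = (a, k) \<or> (i, j) = (k, b)"
  shows "base_chord i j \<subseteq> T"
proof (cases "i + 1 < j")
  case True
  let ?f = "side p i j"
  let ?M = "open_triangle p a k b"
  define I where "I = interior (convex hull (p ` {a..b}))"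
  define C where "C = (\<Union>c\<in>T. chord_segment p c)"
  have cell': "?M \<in> components (I - C)" using cell by (simp add: cells_def I_def C_def)
  then have M: "?M \<subseteq> I - C" by (rule in_components_subset)
  have ijn: "a \<le> i" "i < j" "j \<le> b" "j < n" using ij k by auto
  obtain u where "u \<in> interior (convex hull (p ` {i..j}))"
    using interior_polygon_nonempty[of i j] True ijn by blast
  then have u: "u \<in> I" "?f u < 0"
    using interior_parts(1,2)[OF k] ij by (auto simp: I_def)
  have Mpos: "?f v > 0" if "v \<in> ?M" for v
    using that interior_parts(3)[OF k] ij by auto
  obtain v where v: "v \<in> ?M" using open_triangle_facts(3)[OF k] by blast
  \<comment> \<open>The interior has points on both sides of the line, hence also one on it.\<close>
  have "connected I" unfolding I_def by (intro convex_connected convex_interior convex_convex_hull)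
  then obtain w where w: "w \<in> I" "?f w = 0"
    using connected_ivt_hyperplane[of I u v "side_normal p i j" "side_normal p i j \<bullet> p i"] u v M Mpos[of v]
    by (auto simp: side_def)
  have wseg: "w \<in> closed_segment (p i) (p j)"
    using interior_on_chord_line[of a i j b w] w ijn k by (auto simp: I_def)
  have "closed_segment (p i) (p j) \<subseteq> convex hull (p ` {a, k, b})"
    using ij by (intro closed_segment_subset hull_inc) auto
  then have wcl: "w \<in> closure ?M" unfolding open_triangle_facts(4)[OF k] using wseg by blast
  have "w \<in> C"
  proof (rule ccontr)
    assume "w \<notin> C"
    then have "w \<in> (I - C) \<inter> closure ?M" using w wcl by blast
    also have "(I - C) \<inter> closure ?M = ?M"
    proof -
      obtain D where D: "closed D" "?M = (I - C) \<inter> D"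
        using closedin_component[OF cell'] by (auto simp: closedin_closed)
      then have "closure ?M \<subseteq> D" by (intro closure_minimal) auto
      then show ?thesis using D(2) closure_subset[of ?M] by blast
    qed
    finally show False using Mpos[of w] w by simp
  qed
  then obtain x y where xy: "(x, y) \<in> T" "w \<in> closed_segment (p x) (p y)"
    by (force simp: C_def chord_segment_def)
  have nx: "\<not> (x < k \<and> k < y)" by (rule chord_not_across_cell[OF k T cell xy(1)])
  have r: "a \<le> x" "x < y" "y \<le> b" using xy(1) T by (auto simp: chords_between_def)
  have "(x, y) = (i, j)"
  proof (rule ccontr)
    assume "(x, y) \<noteq> (i, j)"
    then have "closed_segment (p i) (p j) \<inter> closed_segment (p x) (p y) \<inter> I = {}"
      unfolding I_def using ijn r nx ij k by (intro noncrossing_chords_disjoint) auto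
    then show False using w wseg xy by blast
  qed
  then show ?thesis using xy(1) by (simp add: base_chord_def)
qed (simp add: base_chord_def)

section \<open>Proper dissections and their decomposition\<close>

definition proper_cell :: "(nat \<Rightarrow> nat) \<Rightarrow> complex set \<Rightarrow> bool" where
  "proper_cell c R \<longleftrightarrow>
     (\<exists>i j k. i < j \<and> j < k \<and> k < n \<and> R = open_triangle p i j k \<and> c ` {i, j, k} = {1, 2, 3})"

text \<open>
  Only the regions are constrained, so that only they have to be followed through the decomposition;
  lemma \<open>proper_dissection_noncrossing\<close> recovers that the chords do not cross.
\<close>

definition proper_dissection :: "(nat \<Rightarrow> nat) \<Rightarrow> nat \<Rightarrow> nat \<Rightarrow> (nat \<times> nat) set \<Rightarrow> bool" where
  "proper_dissection c a b T \<longleftrightarrow> T \<subseteq> chords_between a b \<and>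
     (\<forall>R\<in>cells p a b T. proper_cell c R)"

lemma proper_dissection_edge:
  assumes "a + 1 < n"
  shows "proper_dissection c a (a + 1) T \<longleftrightarrow> T = {}"
proof -
  have "chords_between a (a + 1) = {}" by (auto simp: chords_between_def)
  moreover have "{a..a + 1} = {a, a + 1}" by auto
  moreover have "interior (convex hull {p a, p (a + 1)}) = {}"
    unfolding segment_convex_hull[symmetric] by (intro interior_closed_segment_ge2) simp
  ultimately show ?thesis by (simp add: proper_dissection_def cells_def)
qed

lemma proper_dissection_glue:
  assumes k: "a < k" "k < b" "b < n" and col: "c ` {a, k, b} = {1, 2, 3}"
    and T: "proper_dissection c a k T1" "proper_dissection c k b T2"
  shows "proper_dissection c a b (T1 \<union> T2 \<union> base_chord a k \<union> base_chord k b)"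
proof -
  have sub: "T1 \<subseteq> chords_between a k" "T2 \<subseteq> chords_between k b"
    using T by (auto simp: proper_dissection_def)
  have "T1 \<union> T2 \<union> base_chord a k \<union> base_chord k b \<subseteq> chords_between a b"
    using sub k by (auto simp: chords_between_def base_chord_def split: if_splits)
  moreover have "proper_cell c R"
    if "R \<in> insert (open_triangle p a k b) (cells p a k T1 \<union> cells p k b T2)" for R
    using that
  proof
    assume "R = open_triangle p a k b"
    then show ?thesis using k col unfolding proper_cell_def by blast
  next
    assume "R \<in> cells p a k T1 \<union> cells p k b T2"
    then show ?thesis using T unfolding proper_dissection_def by blast
  qed
  ultimately show ?thesis
    unfolding proper_dissection_def cells_glue[OF k sub] by blast
qed

text \<open>
  The apex \<open>k\<close> comes from the cell at the midpoint of the base. Since no chord runs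
  past \<open>k\<close>, every chord belongs to one of the two subpolygons or is a side of the
  triangle, and \<open>cells_glue\<close> turns the cells of the subpolygons into cells of the
  whole.
\<close>

lemma proper_dissection_split:
  assumes ab: "a + 1 < b" "b < n" and T: "proper_dissection c a b T"
  shows "\<exists>k T1 T2. a < k \<and> k < b \<and> c ` {a, k, b} = {1, 2, 3} \<and>
    proper_dissection c a k T1 \<and> proper_dissection c k b T2 \<and> T = T1 \<union> T2 \<union> base_chord a k \<union> base_chord k b"
proof -
  have sub: "T \<subseteq> chords_between a b" using T by (simp add: proper_dissection_def)
  obtain R where R: "R \<in> cells p a b T" "midpoint (p a) (p b) \<in> closure R"
    using exists_top_cell[OF ab sub] by blast
  obtain i k j where ijk: "i < k" "k < j" "j < n" "R = open_triangle p i k j" "c ` {i, k, j} = {1, 2, 3}"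
  proof -
    have "proper_cell c R" using T R(1) by (simp add: proper_dissection_def)
    then show ?thesis using that unfolding proper_cell_def by (elim exE conjE)
  qed
  have "R \<subseteq> convex hull (p ` {a..b})"
    using in_components_subset[OF R(1)[unfolded cells_def]] interior_subset by blast
  then have "i = a" "j = b" using triangle_at_base[of a b i k j] ijk R(2) ab by auto
  then have k: "a < k" "k < b" and R': "R = open_triangle p a k b" and col: "c ` {a, k, b} = {1, 2, 3}"
    using ijk by auto
  note cell = R(1)[unfolded R']
  define T1 where "T1 = T \<inter> chords_between a k"
  define T2 where "T2 = T \<inter> chords_between k b"
  have s12: "T1 \<subseteq> chords_between a k" "T2 \<subseteq> chords_between k b" by (auto simp: T1_def T2_def)
  have "base_chord a k \<subseteq> T" "base_chord k b \<subseteq> T"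
    using base_chord_of_cell[OF k ab(2) sub cell] by auto
  moreover have "T \<subseteq> T1 \<union> T2 \<union> base_chord a k \<union> base_chord k b"
  proof (rule subrelI)
    fix x y assume xy: "(x, y) \<in> T"
    have "a \<le> x" "x + 1 < y" "y \<le> b" "\<not> (x < k \<and> k < y)"
      using sub xy chord_not_across_cell[OF k ab(2) sub cell xy] by (auto simp: chords_between_def)
    then show "(x, y) \<in> T1 \<union> T2 \<union> base_chord a k \<union> base_chord k b"
      using xy by (auto simp: T1_def T2_def chords_between_def base_chord_def)
  qed
  ultimately have Teq: "T = T1 \<union> T2 \<union> base_chord a k \<union> base_chord k b"
    unfolding T1_def T2_def by blast
  have "cells p a b T = insert (open_triangle p a k b) (cells p a k T1 \<union> cells p k b T2)"
    using cells_glue[OF k ab(2) s12] Teq by simp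
  then have "proper_dissection c a k T1" "proper_dissection c k b T2"
    using T s12 unfolding proper_dissection_def by blast+
  then show ?thesis using k col Teq by blast
qed

section \<open>Proper triangulations are proper dissections\<close>

text \<open>
  Chords on different sides of the apex of the top triangle cannot interleave, and those on the same
  side are handled by induction.
\<close>

lemma proper_dissection_noncrossing:
  assumes "proper_dissection c a b T" "a < b" "b < n" "(i, j) \<in> T" "(k, l) \<in> T"
  shows "\<not> (i < k \<and> k < j \<and> j < l)"
  using assms
proof (induction "b - a" arbitrary: a b T rule: less_induct)
  case less
  show ?case
  proof (cases "b = a + 1")
    case True
    then have "T = {}" using less.prems proper_dissection_edge[of a c T] by simp
    then show ?thesis using less.prems by simp
  next
    case False
    then obtain m T1 T2 where m: "a < m" "m < b" and T1: "proper_dissection c a m T1"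
      and T2: "proper_dissection c m b T2" and T: "T = T1 \<union> T2 \<union> base_chord a m \<union> base_chord m b"
      using proper_dissection_split[OF _ less.prems(3,1)] less.prems(2) by (metis Suc_eq_plus1 Suc_lessI)
    have s1: "a \<le> x \<and> x < y \<and> y \<le> m" if "(x, y) \<in> T1 \<union> base_chord a m" for x y
      using that T1 m by (auto simp: proper_dissection_def chords_between_def base_chord_def split: if_splits)
    have s2: "m \<le> x \<and> x < y \<and> y \<le> b" if "(x, y) \<in> T2 \<union> base_chord m b" for x y
      using that T2 m by (auto simp: proper_dissection_def chords_between_def base_chord_def split: if_splits)
    have bs: "x = a \<and> y = m" if "(x, y) \<in> base_chord a m" for x y
      using that by (simp add: base_chord_def split: if_splits)
    have bs2: "x = m \<and> y = b" if "(x, y) \<in> base_chord m b" for x y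
      using that by (simp add: base_chord_def split: if_splits)
    have IH1: ?thesis if "(i, j) \<in> T1" "(k, l) \<in> T1"
      using less.hyps[OF _ T1] that m less.prems by auto
    have IH2: ?thesis if "(i, j) \<in> T2" "(k, l) \<in> T2"
      using less.hyps[OF _ T2] that m less.prems by auto
    consider "(i, j) \<in> T1 \<union> base_chord a m" "(k, l) \<in> T1 \<union> base_chord a m"
      | "(i, j) \<in> T2 \<union> base_chord m b" "(k, l) \<in> T2 \<union> base_chord m b"
      | "(i, j) \<in> T1 \<union> base_chord a m" "(k, l) \<in> T2 \<union> base_chord m b"
      | "(i, j) \<in> T2 \<union> base_chord m b" "(k, l) \<in> T1 \<union> base_chord a m"
      using less.prems(4,5) unfolding T by blast
    then show ?thesis
    proof cases
      case 1
      then show ?thesis using s1[OF 1(1)] s1[OF 1(2)] IH1 bs by (metis UnE linorder_not_less)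
    next
      case 2
      then show ?thesis using s2[OF 2(1)] s2[OF 2(2)] IH2 bs2 by (metis UnE linorder_not_less)
    next
      case 3
      show ?thesis using s1[OF 3(1)] s2[OF 3(2)] by linarith
    next
      case 4
      show ?thesis using s2[OF 4(1)] s1[OF 4(2)] by linarith
    qed
  qed
qed

text \<open>
  The complement of the drawing is the disjoint union of two open sets: the exterior of the polygon,
  which is connected and unbounded, and the interior minus the chords, which is bounded.
\<close>

lemma bounded_regions_eq_cells:
  assumes "2 \<le> n" "T \<subseteq> chords_between 0 (n - 1)"
  shows "bounded_regions n p T = cells p 0 (n - 1) T"
proof -
  define P where "P = convex hull (p ` {0..n - 1})"
  define C where "C = (\<Union>c\<in>T. chord_segment p c)"
  have e: "{..<n} = {0..n - 1}" using assms by auto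
  have P: "compact P" "convex P" unfolding P_def by (auto intro!: finite_imp_compact_convex_hull)
  then have cl: "closed P" and bd: "bounded P" by (auto intro: compact_imp_closed compact_imp_bounded)
  have CP: "C \<subseteq> P" unfolding C_def P_def by (rule chord_segments_subset[OF assms(2)])
  have closedC: "closed C" unfolding C_def
    using closed_chords finite_subset[OF assms(2) finite_chords_between] by blast
  have eq: "- (frontier P \<union> C) = - P \<union> (interior P - C)"
    using CP interior_subset[of P] cl by (auto simp: frontier_def)
  have "components (- P \<union> (interior P - C)) = components (- P) \<union> components (interior P - C)"
    using cl closedC interior_subset[of P] by (intro components_Un_disjoint_open) auto
  moreover have "components (- P) = {- P}"
  proof -
    have "connected (- P)" using connected_complement_bounded_convex[OF bd P(2)] by simp
    moreover have "P \<noteq> UNIV" using bd not_bounded_UNIV by metis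
    then have "- P \<noteq> {}" by auto
    ultimately show ?thesis by (simp add: components_eq_sing_iff)
  qed
  moreover have "\<not> bounded (- P)" using bd cobounded_imp_unbounded[of P] by auto
  moreover have "bounded R" if "R \<in> components (interior P - C)" for R
    using in_components_subset[OF that] interior_subset[of P] bd by (meson Diff_subset bounded_subset order_trans)
  ultimately show ?thesis
    unfolding bounded_regions_def polygon_def cells_def e P_def[symmetric] C_def[symmetric] eq by auto
qed

text \<open>
  A triangular region determines its vertices. So asking for properly colored vertices of some
  triangle that equals the region is the same as asking it of every such triangle.
\<close>

lemma proper_triangulation_iff_dissection:
  assumes n: "2 \<le> n"
  shows "proper_triangulation n p T \<longleftrightarrow> proper_dissection (vertex_color n) 0 (n - 1) T"
proof -
  let ?c = "vertex_color n"
  have ch: "chords n = chords_between 0 (n - 1)"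
    using n by (auto simp: chords_def chords_between_def)
  have e: "{..<n} = {0..n - 1}" using n by auto
  show ?thesis
  proof
    assume pt: "proper_triangulation n p T"
    then have T: "triangulation n p T" by (simp add: proper_triangulation_def)
    then have sub: "T \<subseteq> chords_between 0 (n - 1)" by (simp add: triangulation_def ch)
    have "proper_cell ?c R" if R: "R \<in> cells p 0 (n - 1) T" for R
    proof -
      have R': "R \<in> bounded_regions n p T" using R bounded_regions_eq_cells[OF n sub] by simp
      then obtain i j k where ijk: "i < j" "j < k" "k < n" "R = open_triangle p i j k"
      proof -
        have "\<forall>R\<in>bounded_regions n p T. \<exists>i j k. i < j \<and> j < k \<and> k < n \<and> R = open_triangle p i j k"
          using T by (simp add: triangulation_def)
        from bspec[OF this R'] show ?thesis using that by (elim exE conjE)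
      qed
      then have "?c ` {i, j, k} = {1, 2, 3}"
        using pt R' unfolding proper_triangulation_def by blast
      then show ?thesis using ijk unfolding proper_cell_def by blast
    qed
    then show "proper_dissection ?c 0 (n - 1) T" using sub by (simp add: proper_dissection_def)
  next
    assume pd: "proper_dissection ?c 0 (n - 1) T"
    then have sub: "T \<subseteq> chords_between 0 (n - 1)" by (simp add: proper_dissection_def)
    note br = bounded_regions_eq_cells[OF n sub]
    have nc: "chord_segment p d \<inter> chord_segment p d' \<inter> interior (polygon n p) = {}"
      if d: "d \<in> T" "d' \<in> T" "d \<noteq> d'" for d d'
    proof -
      obtain i j k l where ij: "d = (i, j)" "d' = (k, l)" by (metis surj_pair)
      have "i < j" "j < n" "k < l" "l < n"
        using d sub n unfolding ij by (auto simp: chords_between_def)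
      moreover have "\<not> (i < k \<and> k < j \<and> j < l)" "\<not> (k < i \<and> i < l \<and> l < j)"
        using proper_dissection_noncrossing[OF pd] d n unfolding ij by auto
      ultimately show ?thesis
        using noncrossing_chords_disjoint[of i j k l "{..<n}"] d(3) unfolding ij
        by (auto simp: chord_segment_def polygon_def)
    qed
    have pc: "proper_cell ?c R" if "R \<in> bounded_regions n p T" for R
      using that pd by (simp add: br proper_dissection_def)
    have "\<exists>i j k. i < j \<and> j < k \<and> k < n \<and> R = open_triangle p i j k" if "R \<in> bounded_regions n p T" for R
      using pc[OF that] unfolding proper_cell_def by metis
    then have "triangulation n p T" using sub nc unfolding triangulation_def ch by blast
    moreover have "?c ` {i, j, k} = {1, 2, 3}"
      if ijk: "i < j" "j < k" "k < n" and R: "open_triangle p i j k \<in> bounded_regions n p T" for i j k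
    proof -
      obtain i' j' k' where *: "i' < j'" "j' < k'" "k' < n" "open_triangle p i j k = open_triangle p i' j' k'"
        and col: "?c ` {i', j', k'} = {1, 2, 3}"
        using pc[OF R] unfolding proper_cell_def by metis
      then show ?thesis using open_triangle_eqD[OF ijk *] by simp
    qed
    ultimately show "proper_triangulation n p T" unfolding proper_triangulation_def by blast
  qed
qed

section \<open>Counting\<close>

definition num_dissections :: "(nat \<Rightarrow> nat) \<Rightarrow> nat \<Rightarrow> nat \<Rightarrow> nat" where
  "num_dissections c a b = card {T. proper_dissection c a b T}"

lemma num_dissections_edge: "a + 1 < n \<Longrightarrow> num_dissections c a (a + 1) = 1"
  using proper_dissection_edge[of a c] by (simp add: num_dissections_def)

lemma finite_proper_dissections: "finite {T. proper_dissection c a b T}"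
  by (rule finite_subset[of _ "Pow (chords_between a b)"])
    (auto simp: proper_dissection_def finite_chords_between)

text \<open>
  The apex is determined by the dissection: for \<open>k < k'\<close> the chord \<open>(k,
  b)\<close> is forced by the apex \<open>k\<close> and excluded by the apex \<open>k'\<close>.
\<close>

lemma num_dissections_rec:
  assumes ab: "a + 1 < b" "b < n"
  shows "num_dissections c a b =
    (\<Sum>k | a < k \<and> k < b \<and> c ` {a, k, b} = {1, 2, 3}. num_dissections c a k * num_dissections c k b)"
proof -
  define K where "K = {k. a < k \<and> k < b \<and> c ` {a, k, b} = {1, 2, 3}}"
  define D where "D a b = {T. proper_dissection c a b T}" for a b
  define glue where "glue k = (\<lambda>(T1, T2). T1 \<union> T2 \<union> base_chord a k \<union> base_chord k b)" for k
  have Dsub: "T \<subseteq> chords_between x y" if "T \<in> D x y" for T x y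
    using that by (simp add: D_def proper_dissection_def)
  have "D a b = (\<Union>k\<in>K. glue k ` (D a k \<times> D k b))"
  proof (intro set_eqI iffI)
    fix T assume "T \<in> D a b"
    then obtain k T1 T2 where "k \<in> K" "T1 \<in> D a k" "T2 \<in> D k b" "T = glue k (T1, T2)"
      using proper_dissection_split[OF ab, of c T] unfolding D_def K_def glue_def by auto
    then show "T \<in> (\<Union>k\<in>K. glue k ` (D a k \<times> D k b))" by blast
  next
    fix T assume "T \<in> (\<Union>k\<in>K. glue k ` (D a k \<times> D k b))"
    then obtain k T1 T2 where "k \<in> K" "T1 \<in> D a k" "T2 \<in> D k b" "T = glue k (T1, T2)" by auto
    then show "T \<in> D a b"
      using proper_dissection_glue[of a k b c T1 T2] ab unfolding D_def K_def glue_def by auto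
  qed
  moreover have "card (\<Union>k\<in>K. glue k ` (D a k \<times> D k b)) = (\<Sum>k\<in>K. card (glue k ` (D a k \<times> D k b)))"
  proof (rule card_UN_disjoint)
    show "finite K" by (rule finite_subset[of _ "{..b}"]) (auto simp: K_def)
    show "\<forall>k\<in>K. finite (glue k ` (D a k \<times> D k b))"
      by (simp add: D_def finite_proper_dissections)
    have ne: "glue k x \<noteq> glue k' y"
      if k: "k \<in> K" "k' \<in> K" "k < k'" "x \<in> D a k \<times> D k b" "y \<in> D a k' \<times> D k' b" for k k' x y
    proof
      assume e: "glue k x = glue k' y"
      have "k + 1 < b" using k by (auto simp: K_def)
      then have "(k, b) \<in> glue k x" by (auto simp: glue_def base_chord_def split: prod.split)
      moreover obtain T1 T2 where y: "y = (T1, T2)" "T1 \<in> D a k'" "T2 \<in> D k' b" using k(5) by auto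
      ultimately consider "(k, b) \<in> T1" | "(k, b) \<in> T2" | "(k, b) \<in> base_chord a k'" | "(k, b) \<in> base_chord k' b"
        using e by (auto simp: glue_def)
      moreover have "k' < b" using k by (auto simp: K_def)
      ultimately show False
        using k(3) subsetD[OF Dsub[OF y(2)], of "(k, b)"] subsetD[OF Dsub[OF y(3)], of "(k, b)"]
        by cases (simp_all add: base_chord_def chords_between_def split: if_splits)
    qed
    show "\<forall>k\<in>K. \<forall>k'\<in>K. k \<noteq> k' \<longrightarrow> glue k ` (D a k \<times> D k b) \<inter> glue k' ` (D a k' \<times> D k' b) = {}"
    proof (intro ballI impI equals0I)
      fix k k' T
      assume k: "k \<in> K" "k' \<in> K" "k \<noteq> k'"
        and "T \<in> glue k ` (D a k \<times> D k b) \<inter> glue k' ` (D a k' \<times> D k' b)"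
      then obtain x y where "x \<in> D a k \<times> D k b" "y \<in> D a k' \<times> D k' b" "glue k x = glue k' y"
        by blast
      then show False using ne[of k k' x y] ne[of k' k y x] k by (cases "k < k'") auto
    qed
  qed
  moreover have "card (glue k ` (D a k \<times> D k b)) = card (D a k) * card (D k b)" if "k \<in> K" for k
  proof -
    have "glue k (T1, T2) \<inter> chords_between a k = T1 \<and> glue k (T1, T2) \<inter> chords_between k b = T2"
      if "T1 \<in> D a k" "T2 \<in> D k b" for T1 T2
      using Dsub[OF that(1)] Dsub[OF that(2)]
      by (auto simp: glue_def base_chord_def chords_between_def split: if_splits)
    then have "inj_on (glue k) (D a k \<times> D k b)"
      by (intro inj_onI) (metis mem_Sigma_iff prod.collapse)
    then show ?thesis by (simp add: card_image card_cartesian_product)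
  qed
  ultimately show ?thesis by (simp add: num_dissections_def D_def K_def)
qed

text \<open>
  If all vertices but possibly the last are colored cyclically, the apex of the top triangle must
  lie in one residue class modulo 3. The number \<open>z\<close> stands for the position at which
  the last vertex would have its color in the cyclic coloring.
\<close>

lemma num_dissections_by_residue:
  assumes ab: "a + 1 < b" "b < n"
    and c: "\<And>i. a \<le> i \<Longrightarrow> i < b \<Longrightarrow> c i = i mod 3 + 1" "c b = z mod 3 + 1"
    and d: "0 < d" "d < 3"
    and z: "z mod 3 = (a + (3 - d)) mod 3"
    and M: "\<And>i. a + 3 * i + d < b \<longleftrightarrow> i < M"
  shows "num_dissections c a b =
    (\<Sum>i<M. num_dissections c a (a + 3 * i + d) * num_dissections c (a + 3 * i + d) b)"
proof -
  have "{k. a < k \<and> k < b \<and> c ` {a, k, b} = {1, 2, 3}} = {k. a < k \<and> k < b \<and> k mod 3 = (a + d) mod 3}"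
  proof (rule Collect_cong, rule conj_cong[OF refl], rule conj_cong[OF refl])
    fix k assume k: "a < k" "k < b"
    then have "c ` {a, k, b} = {a mod 3 + 1, k mod 3 + 1, z mod 3 + 1}"
      using c ab by auto
    then show "c ` {a, k, b} = {1, 2, 3} \<longleftrightarrow> k mod 3 = (a + d) mod 3"
      using rainbow_iff[of a k z] third_residue_iff[OF d z, of k] by simp
  qed
  also have "\<dots> = (\<lambda>i. a + 3 * i + d) ` {..<M}" by (rule residue_class_between[OF d M])
  finally have "num_dissections c a b =
     (\<Sum>k\<in>(\<lambda>i. a + 3 * i + d) ` {..<M}. num_dissections c a k * num_dissections c k b)"
    using num_dissections_rec[OF ab, of c] by simp
  also have "\<dots> = (\<Sum>i<M. num_dissections c a (a + 3 * i + d) * num_dissections c (a + 3 * i + d) b)"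
    by (subst sum.reindex) (auto simp: inj_on_def)
  finally show ?thesis .
qed

text \<open>
  These are the equations \<open>A = 1 + x B\<^sup>2\<close> and \<open>B = A\<^sup>2\<close>,
  solved by \<open>A = U\<close> and \<open>B = U\<^sup>2\<close>.
\<close>

lemma num_dissections_cyclic:
  assumes c: "\<And>i. i \<le> B \<Longrightarrow> c i = i mod 3 + 1" and "b \<le> B" "b < n"
  shows "(\<forall>m. b = a + 3 * m + 1 \<longrightarrow> num_dissections c a b = fuss_catalan m 1) \<and>
         (\<forall>m. b = a + 3 * m + 2 \<longrightarrow> num_dissections c a b = fuss_catalan m 2)"
  using assms(2,3)
proof (induction "b - a" arbitrary: a b rule: less_induct)
  case less
  note bB = less.prems
  have IH1: "num_dissections c a' b' = fuss_catalan i 1"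
    if "b' = a' + 3 * i + 1" "b' \<le> b" "b' - a' < b - a" for a' b' i
  proof -
    have "b' \<le> B" "b' < n" using that bB by simp_all
    from less.hyps[OF that(3) this, THEN conjunct1, THEN spec, THEN mp, OF that(1)] show ?thesis .
  qed
  have IH2: "num_dissections c a' b' = fuss_catalan i 2"
    if "b' = a' + 3 * i + 2" "b' \<le> b" "b' - a' < b - a" for a' b' i
  proof -
    have "b' \<le> B" "b' < n" using that bB by simp_all
    from less.hyps[OF that(3) this, THEN conjunct2, THEN spec, THEN mp, OF that(1)] show ?thesis .
  qed
  show ?case
  proof (intro conjI allI impI)
    fix m assume b: "b = a + 3 * m + 1"
    show "num_dissections c a b = fuss_catalan m 1"
    proof (cases m)
      case 0
      then show ?thesis using b bB num_dissections_edge[of a c] by simp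
    next
      case (Suc l)
      have "num_dissections c a b =
        (\<Sum>i<m. num_dissections c a (a + 3 * i + 2) * num_dissections c (a + 3 * i + 2) b)"
      proof (rule num_dissections_by_residue[where z = b and d = 2])
        show "b mod 3 = (a + (3 - 2)) mod 3"
          using b by presburger
      next
        show "a + 1 < b" "b < n" using b bB Suc by linarith+
        show "a + 3 * i + 2 < b \<longleftrightarrow> i < m" for i using b by presburger
        show "c b = b mod 3 + 1" using c bB by simp
        show "c i = i mod 3 + 1" if "a \<le> i" "i < b" for i using c that bB by simp
      qed simp_all
      also have "\<dots> = (\<Sum>i\<le>l. fuss_catalan i 2 * fuss_catalan (l - i) 2)"
        unfolding Suc lessThan_Suc_atMost
      proof (rule sum.cong[OF refl])
        fix i assume "i \<in> {..l}"
        then have i: "i \<le> l" by simp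
        then have "b = (a + 3 * i + 2) + 3 * (l - i) + 2" using b Suc by simp
        then have "num_dissections c (a + 3 * i + 2) b = fuss_catalan (l - i) 2"
          by (rule IH2) (use b in simp_all)
        moreover have "num_dissections c a (a + 3 * i + 2) = fuss_catalan i 2"
          by (rule IH2[OF refl]) (use b Suc i in simp_all)
        ultimately show "num_dissections c a (a + 3 * i + 2) * num_dissections c (a + 3 * i + 2) b
            = fuss_catalan i 2 * fuss_catalan (l - i) 2"
          by simp
      qed
      also have "\<dots> = fuss_catalan m 1"
        using fuss_catalan_convolution[of 2 l 2] Suc by simp
      finally show ?thesis .
    qed
  next
    fix m assume b: "b = a + 3 * m + 2"
    have "num_dissections c a b =
      (\<Sum>i<Suc m. num_dissections c a (a + 3 * i + 1) * num_dissections c (a + 3 * i + 1) b)"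
    proof (rule num_dissections_by_residue[where z = b and d = 1])
      show "b mod 3 = (a + (3 - 1)) mod 3"
        using b by presburger
    next
      show "a + 1 < b" "b < n" using b bB by linarith+
      show "a + 3 * i + 1 < b \<longleftrightarrow> i < Suc m" for i using b by presburger
      show "c b = b mod 3 + 1" using c bB by simp
      show "c i = i mod 3 + 1" if "a \<le> i" "i < b" for i using c that bB by simp
    qed simp_all
    also have "\<dots> = (\<Sum>i\<le>m. fuss_catalan i 1 * fuss_catalan (m - i) 1)"
      unfolding lessThan_Suc_atMost
    proof (rule sum.cong[OF refl])
      fix i assume "i \<in> {..m}"
      then have i: "i \<le> m" by simp
      then have "b = (a + 3 * i + 1) + 3 * (m - i) + 1" using b by simp
      then have "num_dissections c (a + 3 * i + 1) b = fuss_catalan (m - i) 1"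
        by (rule IH1) (use b in simp_all)
      moreover have "num_dissections c a (a + 3 * i + 1) = fuss_catalan i 1"
        by (rule IH1[OF refl]) (use b i in simp_all)
      ultimately show "num_dissections c a (a + 3 * i + 1) * num_dissections c (a + 3 * i + 1) b
          = fuss_catalan i 1 * fuss_catalan (m - i) 1"
        by simp
    qed
    also have "\<dots> = fuss_catalan m 2"
      using fuss_catalan_convolution[of 1 m 1] by (simp add: numeral_2_eq_2)
    finally show "num_dissections c a b = fuss_catalan m 2" .
  qed
qed

text \<open>
  These are the equations \<open>C = B D\<close> and \<open>D = 1 + x A C\<close>, solved by
  \<open>C = U\<^sup>3\<close> and \<open>D = U\<close>. The last vertex keeps its color in every
  right-hand subpolygon, while the left-hand subpolygons are colored cyclically.
\<close>

lemma num_dissections_recolored: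
  assumes c: "\<And>i. i < b \<Longrightarrow> c i = i mod 3 + 1" "c b = (b + 1) mod 3 + 1" and b: "b < n"
  shows "(\<forall>m. b = a + 3 * m + 3 \<longrightarrow> num_dissections c a b = fuss_catalan m 3) \<and>
         (\<forall>m. b = a + 3 * m + 1 \<longrightarrow> num_dissections c a b = fuss_catalan m 1)"
proof (induction "b - a" arbitrary: a rule: less_induct)
  case less
  have cyc1: "num_dissections c a (a + 3 * i + 1) = fuss_catalan i 1" if "a + 3 * i + 1 < b" for i
    using num_dissections_cyclic[of "a + 3 * i + 1" c "a + 3 * i + 1" a] c(1) b that by simp
  have cyc2: "num_dissections c a (a + 3 * i + 2) = fuss_catalan i 2" if "a + 3 * i + 2 < b" for i
    using num_dissections_cyclic[of "a + 3 * i + 2" c "a + 3 * i + 2" a] c(1) b that by simp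
  show ?case
  proof (intro conjI allI impI)
    fix m assume ba: "b = a + 3 * m + 3"
    have "num_dissections c a b =
      (\<Sum>i<Suc m. num_dissections c a (a + 3 * i + 2) * num_dissections c (a + 3 * i + 2) b)"
    proof (rule num_dissections_by_residue[where z = "b + 1" and d = 2])
      show "(b + 1) mod 3 = (a + (3 - 2)) mod 3"
        using ba by presburger
    next
      show "a + 1 < b" "b < n" using ba b by linarith+
      show "a + 3 * i + 2 < b \<longleftrightarrow> i < Suc m" for i using ba by presburger
      show "c b = (b + 1) mod 3 + 1" by (rule c(2))
      show "c i = i mod 3 + 1" if "a \<le> i" "i < b" for i using c that by simp
    qed simp_all
    also have "\<dots> = (\<Sum>i\<le>m. fuss_catalan i 2 * fuss_catalan (m - i) 1)"
      unfolding lessThan_Suc_atMost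
    proof (rule sum.cong[OF refl])
      fix i assume "i \<in> {..m}"
      then have i: "i \<le> m" by simp
      have "num_dissections c (a + 3 * i + 2) b = fuss_catalan (m - i) 1"
      proof -
        have "b - (a + 3 * i + 2) < b - a" "b = a + 3 * i + 2 + 3 * (m - i) + 1" using ba i by simp_all
        from less.hyps[OF this(1), THEN conjunct2, THEN spec, THEN mp, OF this(2)] show ?thesis .
      qed
      then show "num_dissections c a (a + 3 * i + 2) * num_dissections c (a + 3 * i + 2) b
          = fuss_catalan i 2 * fuss_catalan (m - i) 1"
        using cyc2[of i] ba i by simp
    qed
    also have "\<dots> = fuss_catalan m 3"
      using fuss_catalan_convolution[of 2 m 1] by simp
    finally show "num_dissections c a b = fuss_catalan m 3" .
  next
    fix m assume ba: "b = a + 3 * m + 1"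
    show "num_dissections c a b = fuss_catalan m 1"
    proof (cases m)
      case 0
      then show ?thesis using ba b num_dissections_edge[of a c] by simp
    next
      case (Suc l)
      have "num_dissections c a b =
        (\<Sum>i<m. num_dissections c a (a + 3 * i + 1) * num_dissections c (a + 3 * i + 1) b)"
      proof (rule num_dissections_by_residue[where z = "b + 1" and d = 1])
        show "(b + 1) mod 3 = (a + (3 - 1)) mod 3"
          using ba by presburger
      next
        show "a + 1 < b" "b < n" using ba b Suc by linarith+
        show "a + 3 * i + 1 < b \<longleftrightarrow> i < m" for i using ba by presburger
        show "c b = (b + 1) mod 3 + 1" by (rule c(2))
        show "c i = i mod 3 + 1" if "a \<le> i" "i < b" for i using c that by simp
      qed simp_all
      also have "\<dots> = (\<Sum>i\<le>l. fuss_catalan i 1 * fuss_catalan (l - i) 3)"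
        unfolding Suc lessThan_Suc_atMost
      proof (rule sum.cong[OF refl])
        fix i assume "i \<in> {..l}"
        then have i: "i \<le> l" by simp
        have "num_dissections c (a + 3 * i + 1) b = fuss_catalan (l - i) 3"
        proof -
          have "b - (a + 3 * i + 1) < b - a" "b = a + 3 * i + 1 + 3 * (l - i) + 3" using ba i Suc by simp_all
          from less.hyps[OF this(1), THEN conjunct1, THEN spec, THEN mp, OF this(2)] show ?thesis .
        qed
        then show "num_dissections c a (a + 3 * i + 1) * num_dissections c (a + 3 * i + 1) b
            = fuss_catalan i 1 * fuss_catalan (l - i) 3"
          using cyc1[of i] ba i Suc by simp
      qed
      also have "\<dots> = fuss_catalan m 1"
        using fuss_catalan_convolution[of 1 l 3] Suc by simp
      finally show ?thesis .
    qed
  qed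
qed

lemma num_proper_eq_num_dissections:
  assumes "n = N + 2"
  shows "num_proper N p = num_dissections (vertex_color n) 0 (n - 1)"
proof -
  have "2 \<le> n" using assms by simp
  then have "proper_triangulation n p = proper_dissection (vertex_color n) 0 (n - 1)"
    using proper_triangulation_iff_dissection by blast
  then show ?thesis by (simp only: num_proper_def num_dissections_def assms[symmetric])
qed

lemma num_proper_eq_fuss_catalan:
  shows "n = 3 * m + 2 \<Longrightarrow> num_proper (3 * m) p = fuss_catalan m 1"
    and "n = (3 * m + 1) + 2 \<Longrightarrow> num_proper (3 * m + 1) p = fuss_catalan m 2"
    and "n = (3 * m + 2) + 2 \<Longrightarrow> num_proper (3 * m + 2) p = fuss_catalan m 3"
proof -
  have cyc: "vertex_color n i = i mod 3 + 1" if "n mod 3 \<noteq> 1" for i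
    using that by (simp add: vertex_color_def)
  show "num_proper (3 * m) p = fuss_catalan m 1" if n: "n = 3 * m + 2"
  proof -
    have *: "n mod 3 \<noteq> 1" "n - 1 < n" "n - 1 = 0 + 3 * m + 1" using n by presburger+
    from num_dissections_cyclic[of "n - 1" "vertex_color n", OF cyc[OF *(1)] order_refl *(2),
        THEN conjunct1, THEN spec, THEN mp, OF *(3)]
    show ?thesis using num_proper_eq_num_dissections[OF n] by simp
  qed
  show "num_proper (3 * m + 1) p = fuss_catalan m 2" if n: "n = (3 * m + 1) + 2"
  proof -
    have *: "n mod 3 \<noteq> 1" "n - 1 < n" "n - 1 = 0 + 3 * m + 2" using n by presburger+
    from num_dissections_cyclic[of "n - 1" "vertex_color n", OF cyc[OF *(1)] order_refl *(2),
        THEN conjunct2, THEN spec, THEN mp, OF *(3)]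
    show ?thesis using num_proper_eq_num_dissections[OF n] by simp
  qed
  show "num_proper (3 * m + 2) p = fuss_catalan m 3" if n: "n = (3 * m + 2) + 2"
  proof -
    have n_mod: "n mod 3 = 1" using n by presburger
    have *: "n - 1 < n" "n - 1 = 0 + 3 * m + 3" "n - 1 + 1 = n" using n by simp_all
    have 1: "vertex_color n i = i mod 3 + 1" if "i < n - 1" for i using that by (simp add: vertex_color_def)
    have "vertex_color n (n - 1) = 2" using n_mod by (simp add: vertex_color_def)
    then have 2: "vertex_color n (n - 1) = (n - 1 + 1) mod 3 + 1" unfolding *(3) n_mod by simp
    have "\<forall>m. n - 1 = 0 + 3 * m + 3 \<longrightarrow> num_dissections (vertex_color n) 0 (n - 1) = fuss_catalan m 3"
      using num_dissections_recolored[of "n - 1" "vertex_color n" 0] 1 2 *(1) by blast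
    then have "num_dissections (vertex_color n) 0 (n - 1) = fuss_catalan m 3" using *(2) by blast
    then show ?thesis using num_proper_eq_num_dissections[OF n] by simp
  qed
qed

end

lemma convex_polygon_imp_convex_vertices: "convex_polygon n p \<Longrightarrow> convex_vertices n p"
  by (auto simp: convex_polygon_def convex_vertices_def)

theorem theorem2p2:
  fixes n :: nat
  shows "(\<forall>p. convex_polygon (3 * n + 2) p \<longrightarrow>
            real (num_proper (3 * n) p) = 1 / real (3 * n + 1) * real ((4 * n) choose n)) \<and>
         (\<forall>p. convex_polygon ((3 * n + 1) + 2) p \<longrightarrow>
            real (num_proper (3 * n + 1) p) = 2 / real (3 * n + 2) * real ((4 * n + 1) choose n)) \<and>
         (\<forall>p. convex_polygon ((3 * n + 2) + 2) p \<longrightarrow>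
            real (num_proper (3 * n + 2) p) = 3 / real (3 * n + 3) * real ((4 * n + 2) choose n))"
proof -
  have *: "real (fuss_catalan n (Suc r)) = real (Suc r) / real (3 * n + Suc r) * real ((4 * n + r) choose n)" for r
  proof -
    have "real (3 * n + Suc r) * real (fuss_catalan n (Suc r)) = real (Suc r) * real ((4 * n + r) choose n)"
      using fuss_catalan_closed_form[of n r] by (metis of_nat_mult)
    then show ?thesis by (simp add: field_simps del: of_nat_Suc of_nat_add)
  qed
  show ?thesis
  proof (intro conjI allI impI)
    fix p assume "convex_polygon (3 * n + 2) p"
    then have "num_proper (3 * n) p = fuss_catalan n (Suc 0)"
      using convex_vertices.num_proper_eq_fuss_catalan(1)[OF convex_polygon_imp_convex_vertices refl] by simp
    then show "real (num_proper (3 * n) p) = 1 / real (3 * n + 1) * real ((4 * n) choose n)"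
      using *[of 0] by simp
  next
    fix p assume "convex_polygon ((3 * n + 1) + 2) p"
    then have "num_proper (3 * n + 1) p = fuss_catalan n (Suc 1)"
      using convex_vertices.num_proper_eq_fuss_catalan(2)[OF convex_polygon_imp_convex_vertices refl]
      by (simp add: numeral_2_eq_2)
    then show "real (num_proper (3 * n + 1) p) = 2 / real (3 * n + 2) * real ((4 * n + 1) choose n)"
      using *[of 1] by simp
  next
    fix p assume "convex_polygon ((3 * n + 2) + 2) p"
    then have "num_proper (3 * n + 2) p = fuss_catalan n (Suc 2)"
      using convex_vertices.num_proper_eq_fuss_catalan(3)[OF convex_polygon_imp_convex_vertices refl]
      by (simp add: numeral_3_eq_3)
    then show "real (num_proper (3 * n + 2) p) = 3 / real (3 * n + 3) * real ((4 * n + 2) choose n)"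
      using *[of 2] by simp
  qed
qed

end
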